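(* Assume the following. (a) For every $i$: with probability $1$, $$\mathbf{M}_i(\mathbf{t}_2,X_i)-\mathbf{M}_i(\mathbf{t}_1,X_i)=\int_0^1\mathrm{M}_i'(\mathbf{t}_1+v(\mathbf{t}_2-\mathbf{t}_1),X_i)\,dv\cdot(\mathbf{t}_2-\mathbf{t}_1)$$ for all segments $(\mathbf{t}_1,\mathbf{t}_2)$ lying entirely in $\boldsymbol\Theta$ (with endpoints in $\boldsymbol\Theta$); the expectations of all entries of $\mathrm{M}_i'(\boldsymbol\theta,X_i)$ are finite, $\mathbb{E}\mathbf{M}_i(\boldsymbol\theta,X_i)=\mathbf{0}$ and $\mathbb{E}\|\mathbf{M}_i(\boldsymbol\theta,X_i)\|^2<\infty$. (b) For all sufficiently large $n$ the matrix $\mathrm{J}_n$ is nonsingular and the matrix $\mathrm{I}_n$ is positive definite; moreover $\|\mathrm{I}_n^{-1/2}\|\|\mathrm{J}_n\|\to\infty$, $\sup_n\|\mathrm{I}_n^{1/2}\|\|\mathrm{I}_n^{-1/2}\|<\infty$, $$\sum_{i=1}^n\mathrm{M}_i'(\boldsymbol\theta,X_i)\,\mathrm{J}_n^{-1}\xrightarrow{p}\mathrm{I},\qquad\mathrm{I}_n^{-1/2}\sum_{i=1}^n\mathbf{M}_i(\boldsymbol\theta,X_i)\Rightarrow\mathcal{N}(\mathbf{0},\mathrm{I}).$$ (c) $\lim_{r\to0}\limsup_{n\to\infty}\overline\tau_n(r)=0$. (d) The estimator $\boldsymbol\theta_n^*=\boldsymbol\theta_n^*(X_1,\dots,X_n)$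 satisfies $\|\mathrm{I}_n^{-1/2}\|\|\mathrm{J}_n\|\|\boldsymbol\theta_n^*-\boldsymbol\theta\|\,\overline\tau_n(\|\boldsymbol\theta_n^*-\boldsymbol\theta\|)\xrightarrow{p}0$. Then the one-step $M$-estimator $$\boldsymbol\theta_{n,M}^{**}=\boldsymbol\theta_n^*-\Big(\sum_{i=1}^n\mathrm{M}_i'(\boldsymbol\theta_n^*,X_i)\Big)^{-1}\sum_{i=1}^n\mathbf{M}_i(\boldsymbol\theta_n^*,X_i)$$ is defined with probability tending to $1$ and $$\mathrm{I}_n^{-1/2}\mathrm{J}_n\big(\boldsymbol\theta_{n,M}^{**}-\boldsymbol\theta\big)\Rightarrow\mathcal{N}(\mathbf{0},\mathrm{I}).$$
   Context: All limits are as $n\to\infty$ unless stated otherwise; $\xrightarrow{p}$ is convergence in probability, $\Rightarrow$ is weak convergence. Vectors are column vectors in $\mathbb{R}^m$, matrices are $m\times m$; $\|\mathbf{x}\|$ is the Euclidean norm and $\|\mathrm{B}\|$ is the square root of the sum of squares of the entries of $\mathrm{B}$. $\mathrm{I}$ (without index) is the identity matrix and $\mathcal{N}(\mathbf{0},\mathrm{I})$ the standard $m$-dimensional normal law. $\mathrm{D}^{1/2}$ is the unique symmetric nonnegative definite square root of a symmetric nonnegative definite $\mathrm{D}$. Setting: for each $n$ one observes independent elements $X_1,\dots,X_n$ of an arbitrary measurable space, not necessarily identically distributed, whose distributions depend on an unknown parameter in an open set $\boldsymbol\Theta\subset\mathbb{R}^m$, and may depend on $n$ and on nuisance parameters. $\boldsymbol\theta\in\boldsymbol\Theta$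 denotes the (fixed) true value and $\mathbb{E}$ the expectation under the true distribution. For each $i$ there are given $m$-dimensional vectors $\mathbf{M}_i(\mathbf{t},X_i)$ and $m\times m$ matrices $\mathrm{M}_i'(\mathbf{t},X_i)$, $\mathbf{t}\in\boldsymbol\Theta$ (possibly depending on $n$). Notation: $\mathrm{J}_n=\sum_{i=1}^n\mathbb{E}\mathrm{M}_i'(\boldsymbol\theta,X_i)$, $\mathrm{I}_n=\sum_{i=1}^n\mathbb{E}\mathbf{M}_i(\boldsymbol\theta,X_i)\mathbf{M}_i^\top(\boldsymbol\theta,X_i)$, $\overline\tau_n(r)=\sum_{i=1}^n\mathbb{E}\tau_i(r,X_i)$ for $r\ge0$, where $\tau_i(r,X_i)=\sup_{\mathbf{t}:\|\mathbf{t}-\boldsymbol\theta\|\le r}\big\|\big(\mathrm{M}_i'(\mathbf{t},X_i)-\mathrm{M}_i'(\boldsymbol\theta,X_i)\big)\mathrm{J}_n^{-1}\big\|$ if the closed ball $\{\mathbf{t}:\|\mathbf{t}-\boldsymbol\theta\|\le r\}$ lies in $\boldsymbol\Theta$, and $\tau_i(r,X_i)=\infty$ otherwise. A statistic is "defined with probability tending to $1$" if the probability that all quantities in its definition are defined ($\boldsymbol\theta_n^*\in\boldsymbol\Theta$, the matrix inverse exists) tends to $1$. *)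

theory Defs
  imports "HOL-Probability.Probability"
begin

text \<open>The matrix norm \<open>norm\<close> of the type \<open>real^'m^'m\<close> is the Euclidean norm of the vector of all
  entries.\<close>

definition pos_semidef_mat :: "real^'m^'m \<Rightarrow> bool" where
  "pos_semidef_mat D \<longleftrightarrow> transpose D = D \<and> (\<forall>v. 0 \<le> v \<bullet> (D *v v))"

definition pos_def_mat :: "real^'m^'m \<Rightarrow> bool" where
  "pos_def_mat D \<longleftrightarrow> transpose D = D \<and> (\<forall>v. v \<noteq> 0 \<longrightarrow> 0 < v \<bullet> (D *v v))"

definition mat_sqrt :: "real^'m^'m \<Rightarrow> real^'m^'m" where
  "mat_sqrt D = (THE R. pos_semidef_mat R \<and> R ** R = D)"

definition mat_inv_sqrt :: "real^'m^'m \<Rightarrow> real^'m^'m" where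
  "mat_inv_sqrt D = matrix_inv (mat_sqrt D)"

definition outer :: "real^'m \<Rightarrow> real^'m \<Rightarrow> real^'m^'m" where
  "outer u v = (\<chi> j k. u $ j * v $ k)"

definition std_normal_vec :: "(real^'m) measure" where
  "std_normal_vec = density lborel (\<lambda>x. ennreal (\<Prod>j\<in>UNIV. std_normal_density (x $ j)))"

definition weakly_converges ::
  "(nat \<Rightarrow> 'b::topological_space measure) \<Rightarrow> 'b measure \<Rightarrow> bool" where
  "weakly_converges \<mu> \<nu> \<longleftrightarrow>
     (\<forall>f :: 'b \<Rightarrow> real. continuous_on UNIV f \<and> bounded (range f) \<longrightarrow>
        (\<lambda>n. \<integral>x. f x \<partial>\<mu> n) \<longlonglongrightarrow> (\<integral>x. f x \<partial>\<nu>))"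

definition converges_in_distr ::
  "(nat \<Rightarrow> 'w measure) \<Rightarrow> (nat \<Rightarrow> 'w \<Rightarrow> 'b::topological_space) \<Rightarrow> 'b measure \<Rightarrow> bool" where
  "converges_in_distr P Y \<nu> \<longleftrightarrow> weakly_converges (\<lambda>n. distr (P n) borel (Y n)) \<nu>"

definition converges_in_prob ::
  "(nat \<Rightarrow> 'w measure) \<Rightarrow> (nat \<Rightarrow> 'w \<Rightarrow> 'b::metric_space) \<Rightarrow> 'b \<Rightarrow> bool" where
  "converges_in_prob P Y c \<longleftrightarrow>
     (\<forall>\<epsilon>>0. (\<lambda>n. measure (P n) {\<omega> \<in> space (P n). dist (Y n \<omega>) c > \<epsilon>}) \<longlonglongrightarrow> 0)"

text \<open>Convergence in probability to zero of random variables with values in \<open>[0, \<infinity>]\<close>.\<close>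

definition converges_in_prob_0 ::
  "(nat \<Rightarrow> 'w measure) \<Rightarrow> (nat \<Rightarrow> 'w \<Rightarrow> ennreal) \<Rightarrow> bool" where
  "converges_in_prob_0 P Y \<longleftrightarrow>
     (\<forall>\<epsilon>>0. (\<lambda>n. measure (P n) {\<omega> \<in> space (P n). Y n \<omega> > ennreal \<epsilon>}) \<longlonglongrightarrow> 0)"

text \<open>In what follows \<open>P n\<close> is the true distribution in the \<open>n\<close>-th experiment, \<open>X n i\<close>
  (\<open>1 \<le> i \<le> n\<close>) are its observations, and \<open>M n i t x\<close> and \<open>M' n i t x\<close> are the vector and the matrix
  attached to the parameter value \<open>t\<close> and to the value \<open>x\<close> of the \<open>i\<close>-th observation.\<close>

definition J_mat ::
  "(nat \<Rightarrow> 'w measure) \<Rightarrow> (nat \<Rightarrow> nat \<Rightarrow> 'w \<Rightarrow> 'x) \<Rightarrow>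
   (nat \<Rightarrow> nat \<Rightarrow> real^'m \<Rightarrow> 'x \<Rightarrow> real^'m^'m) \<Rightarrow> real^'m \<Rightarrow> nat \<Rightarrow> real^'m^'m" where
  "J_mat P X M' \<theta> n = (\<Sum>i=1..n. \<integral>\<omega>. M' n i \<theta> (X n i \<omega>) \<partial>P n)"

definition I_mat ::
  "(nat \<Rightarrow> 'w measure) \<Rightarrow> (nat \<Rightarrow> nat \<Rightarrow> 'w \<Rightarrow> 'x) \<Rightarrow>
   (nat \<Rightarrow> nat \<Rightarrow> real^'m \<Rightarrow> 'x \<Rightarrow> real^'m) \<Rightarrow> real^'m \<Rightarrow> nat \<Rightarrow> real^'m^'m" where
  "I_mat P X M \<theta> n =
     (\<Sum>i=1..n. \<integral>\<omega>. outer (M n i \<theta> (X n i \<omega>)) (M n i \<theta> (X n i \<omega>)) \<partial>P n)"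

definition tau ::
  "(nat \<Rightarrow> 'w measure) \<Rightarrow> (nat \<Rightarrow> nat \<Rightarrow> 'w \<Rightarrow> 'x) \<Rightarrow>
   (nat \<Rightarrow> nat \<Rightarrow> real^'m \<Rightarrow> 'x \<Rightarrow> real^'m^'m) \<Rightarrow> (real^'m) set \<Rightarrow> real^'m \<Rightarrow>
   nat \<Rightarrow> nat \<Rightarrow> real \<Rightarrow> 'x \<Rightarrow> ennreal" where
  "tau P X M' \<Theta> \<theta> n i r x =
     (if cball \<theta> r \<subseteq> \<Theta>
      then SUP t\<in>cball \<theta> r.
             ennreal (norm ((M' n i t x - M' n i \<theta> x) ** matrix_inv (J_mat P X M' \<theta> n)))
      else \<infinity>)"

definition tau_bar ::
  "(nat \<Rightarrow> 'w measure) \<Rightarrow> (nat \<Rightarrow> nat \<Rightarrow> 'w \<Rightarrow> 'x) \<Rightarrow>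
   (nat \<Rightarrow> nat \<Rightarrow> real^'m \<Rightarrow> 'x \<Rightarrow> real^'m^'m) \<Rightarrow> (real^'m) set \<Rightarrow> real^'m \<Rightarrow>
   nat \<Rightarrow> real \<Rightarrow> ennreal" where
  "tau_bar P X M' \<Theta> \<theta> n r = (\<Sum>i=1..n. \<integral>\<^sup>+\<omega>. tau P X M' \<Theta> \<theta> n i r (X n i \<omega>) \<partial>P n)"

text \<open>The estimator is a function of the sample \<open>(X n 1, \<dots>, X n n)\<close> only.\<close>

definition est_value ::
  "(nat \<Rightarrow> nat \<Rightarrow> 'w \<Rightarrow> 'x) \<Rightarrow> (nat \<Rightarrow> (nat \<Rightarrow> 'x) \<Rightarrow> real^'m) \<Rightarrow> nat \<Rightarrow> 'w \<Rightarrow> real^'m" where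
  "est_value X est n \<omega> = est n (\<lambda>i\<in>{1..n}. X n i \<omega>)"

definition one_step_defined ::
  "(nat \<Rightarrow> nat \<Rightarrow> 'w \<Rightarrow> 'x) \<Rightarrow> (nat \<Rightarrow> nat \<Rightarrow> real^'m \<Rightarrow> 'x \<Rightarrow> real^'m^'m) \<Rightarrow>
   (real^'m) set \<Rightarrow> (nat \<Rightarrow> (nat \<Rightarrow> 'x) \<Rightarrow> real^'m) \<Rightarrow> nat \<Rightarrow> 'w \<Rightarrow> bool" where
  "one_step_defined X M' \<Theta> est n \<omega> \<longleftrightarrow>
     est_value X est n \<omega> \<in> \<Theta> \<and>
     invertible (\<Sum>i=1..n. M' n i (est_value X est n \<omega>) (X n i \<omega>))"

text \<open>The argument \<open>d\<close> supplies the values of the one-step estimator where its formula is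
  undefined.\<close>

definition one_step ::
  "(nat \<Rightarrow> nat \<Rightarrow> 'w \<Rightarrow> 'x) \<Rightarrow> (nat \<Rightarrow> nat \<Rightarrow> real^'m \<Rightarrow> 'x \<Rightarrow> real^'m) \<Rightarrow>
   (nat \<Rightarrow> nat \<Rightarrow> real^'m \<Rightarrow> 'x \<Rightarrow> real^'m^'m) \<Rightarrow> (real^'m) set \<Rightarrow>
   (nat \<Rightarrow> (nat \<Rightarrow> 'x) \<Rightarrow> real^'m) \<Rightarrow> (nat \<Rightarrow> 'w \<Rightarrow> real^'m) \<Rightarrow> nat \<Rightarrow> 'w \<Rightarrow> real^'m" where
  "one_step X M M' \<Theta> est d n \<omega> =
     (if one_step_defined X M' \<Theta> est n \<omega>
      then est_value X est n \<omega>
           - matrix_inv (\<Sum>i=1..n. M' n i (est_value X est n \<omega>) (X n i \<omega>))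
             *v (\<Sum>i=1..n. M n i (est_value X est n \<omega>) (X n i \<omega>))
      else d n \<omega>)"

end

(* Write A, J for the matrices I_n^(-1/2), J_n, write t for the preliminary estimator, r for
its distance to theta, and T(r) for the sum over i of tau_i(r, X_i). Both the derivative matrix at t and the averaged
derivative along the segment from theta to t differ from the derivative matrix at theta by at most T(r), after
multiplication by J^(-1). Hence A J (theta** - theta) + A (sum of M_i at theta) is bounded by a small multiple of
the norm of A (sum of M_i at theta), plus a multiple of |A| |J| r T(r). Here r is random and depends on the
sample, so condition (d) says nothing directly about T(r). But T is monotone in r: with
high probability r is at most a deterministic radius at which the condition still holds, and there Markov's
inequality applies. Condition (c) is only needed for small r: for r bounded away from zero the rate
|A| |J| r tends to infinity, so (d) already forces the expectation of T(r) to be small, and consistency of t is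
never used. The limit law follows by Slutsky's theorem and the symmetry of the normal law. *)

theory Submission
  imports Defs
begin

text \<open>Four obstacles shape the proof. (1) T at the random radius is an uncountable supremum
  over a random ball, so nothing makes it measurable; smallness is therefore stated through
  measurable sets contained in the good event, and measurability is established for the final event
  and for the estimator itself. (2) The supremum of the radii admissible in (d) may fail to be
  admissible: already the radii whose closed ball lies in the open set \<open>\<Theta>\<close> can
  form a half-open interval. Hence the passage through a compact set of radii. (3) A need not
  commute with the near-identity matrix of the Newton step. Pulling A past it costs the condition
  number |A| |A^(-1)|, which (b) bounds, and needs that A really inverts a square root; this is why
  existence and uniqueness of the root are proved. (4) The error is small only relative to 1 + |A
  (sum of M_i at theta)|, so the Slutsky argument is stated for errors of this relative kind.
  Definedness comes from the convention that tau is infinite off \<open>\<Theta>\<close>: a finite T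
  puts the closed ball around theta through t, hence t and its segment to theta, inside
  \<open>\<Theta>\<close>.\<close>

section \<open>Euclidean matrix norm and matrix inverses\<close>

lemma norm_matrix_vector_mult_le:
  fixes A :: "real^'n^'m"
  shows "norm (A *v x) \<le> norm A * norm x"
proof -
  have "norm (A *v x) = L2_set (\<lambda>i. norm (A $ i \<bullet> x)) UNIV"
    by (simp add: norm_vec_def matrix_mult_dot)
  also have "\<dots> \<le> L2_set (\<lambda>i. norm x * norm (A $ i)) UNIV"
    by (intro L2_set_mono) (auto simp: mult.commute[of "norm x"] Cauchy_Schwarz_ineq2)
  also have "\<dots> = norm A * norm x"
    by (simp add: L2_set_right_distrib[symmetric] norm_vec_def[of A] mult.commute)
  finally show ?thesis .
qed

lemma norm_transpose: "norm (transpose A) = norm (A :: real^'n^'m)"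
proof -
  have "(norm (transpose A))\<^sup>2 = (norm A)\<^sup>2"
    unfolding power2_norm_eq_inner inner_vec_def transpose_def
    by (simp add: sum.swap[of _ "UNIV :: 'n set"])
  then show ?thesis by simp
qed

lemma norm_matrix_matrix_mult_le:
  fixes A :: "real^'n^'m" and B :: "real^'p^'n"
  shows "norm (A ** B) \<le> norm A * norm B"
proof -
  have row: "(A ** B) $ i = transpose B *v (A $ i)" for i
    by (simp add: vec_eq_iff matrix_matrix_mult_def matrix_vector_mult_def transpose_def mult.commute)
  have "norm (A ** B) = L2_set (\<lambda>i. norm (transpose B *v (A $ i))) UNIV"
    by (simp add: norm_vec_def[of "A ** B"] row)
  also have "\<dots> \<le> L2_set (\<lambda>i. norm B * norm (A $ i)) UNIV"
    using norm_matrix_vector_mult_le[of "transpose B"] by (intro L2_set_mono) (auto simp: norm_transpose)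
  also have "\<dots> = norm A * norm B"
    by (simp add: L2_set_right_distrib[symmetric] norm_vec_def[of A] mult.commute)
  finally show ?thesis .
qed

lemma matrix_add_rdistrib: "(A + B) ** C = A ** C + B ** (C :: real^'p^'n)"
  by (simp add: matrix_matrix_mult_def vec_eq_iff distrib_right sum.distrib)

lemma matrix_diff_rdistrib: "(A - B) ** C = A ** C - B ** (C :: real^'p^'n)"
  by (simp add: matrix_matrix_mult_def vec_eq_iff left_diff_distrib sum_subtractf)

lemma bounded_linear_matrix_mult_right: "bounded_linear (\<lambda>B. B ** (C :: real^'p^'n) :: real^'p^'m)"
  by (rule bounded_linear_intro[where K = "norm C"])
    (auto simp: matrix_add_rdistrib norm_matrix_matrix_mult_le scalar_matrix_assoc)

lemma matrix_diff_ldistrib: "C ** (A - B) = C ** A - C ** (B :: real^'p^'n)"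
  by (simp add: matrix_matrix_mult_def vec_eq_iff right_diff_distrib sum_subtractf)

lemma matrix_inv_eqI:
  fixes A B :: "real^'m^'m"
  assumes "A ** B = mat 1"
  shows "matrix_inv A = B"
proof -
  have BA: "B ** A = mat 1" using assms by (simp add: matrix_left_right_inverse)
  have "A ** matrix_inv A = mat 1"
    unfolding matrix_inv_def by (rule someI2[of _ B]) (auto simp: assms BA)
  then have "B ** (A ** matrix_inv A) = B" by simp
  then show ?thesis by (simp add: matrix_mul_assoc BA)
qed

lemma invertible_matrix_inv:
  assumes "invertible (A :: real^'m^'m)"
  shows "A ** matrix_inv A = mat 1" "matrix_inv A ** A = mat 1"
  using assms matrix_inv_eqI by (auto simp: invertible_def)

section \<open>Square roots of positive definite matrices\<close>

lemma symmetric_matrix_inner: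
  assumes "transpose A = (A :: real^'m^'m)"
  shows "u \<bullet> (A *v v) = (A *v u) \<bullet> v"
  using assms by (metis dot_lmul_matrix transpose_matrix_vector)

text \<open>By compactness the quadratic form attains a positive minimum on the unit sphere;
  homogeneity carries the bound to all vectors.\<close>

lemma pos_def_mat_coercive:
  assumes "pos_def_mat (D :: real^'m^'m)"
  obtains c where "c > 0" "\<And>v. c * (norm v)\<^sup>2 \<le> v \<bullet> (D *v v)"
proof -
  have "continuous_on (sphere 0 1) (\<lambda>v. v \<bullet> (D *v v))"
    by (intro continuous_intros)
  moreover have "sphere (0 :: real^'m) 1 \<noteq> {}" by simp
  ultimately obtain u :: "real^'m" where u: "norm u = 1" "\<And>v. norm v = 1 \<Longrightarrow> u \<bullet> (D *v u) \<le> v \<bullet> (D *v v)"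
    using continuous_attains_inf[of "sphere (0 :: real^'m) 1" "\<lambda>v. v \<bullet> (D *v v)"] by auto
  show thesis
  proof
    have "u \<noteq> 0" using u(1) by auto
    then show "u \<bullet> (D *v u) > 0" using assms by (auto simp: pos_def_mat_def)
    fix v :: "real^'m"
    show "(u \<bullet> (D *v u)) * (norm v)\<^sup>2 \<le> v \<bullet> (D *v v)"
    proof (cases "v = 0")
      case False
      define w where "w = v /\<^sub>R norm v"
      have w: "norm w = 1" "v = norm v *\<^sub>R w" using False by (auto simp: w_def)
      have "v \<bullet> (D *v v) = (norm v *\<^sub>R w) \<bullet> (D *v (norm v *\<^sub>R w))"
        using w(2) by (rule arg_cong)
      also have "\<dots> = (norm v)\<^sup>2 * (w \<bullet> (D *v w))"
        by (simp add: matrix_vector_mult_scaleR power2_eq_square)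
      finally have "v \<bullet> (D *v v) = (w \<bullet> (D *v w)) * (norm v)\<^sup>2" by (simp only: mult.commute)
      with mult_right_mono[OF u(2)[OF w(1)] zero_le_power2] show ?thesis by (simp only:)
    qed simp
  qed
qed

text \<open>The substitution \<open>R = I - Y\<close> turns \<open>R\<^sup>2 = D\<close> into the fixed point equation
  \<open>Y = (C + Y\<^sup>2) / 2\<close> with \<open>C = I - D\<close>, a contraction on the self-adjoint operators of norm at most
  \<open>q\<close>. The norm has to be the operator norm, because the identity has a large Euclidean norm.\<close>

lemma pos_semidef_sqrt_exists_of_near_identity:
  fixes D :: "real^'m^'m"
  assumes sym: "transpose D = D" and q: "0 \<le> q" "q < 1"
    and near: "\<And>v. norm (v - D *v v) \<le> q * norm v"
  shows "\<exists>R. pos_semidef_mat R \<and> R ** R = D"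
proof -
  have bl: "bounded_linear (\<lambda>v. v - D *v v)"
    by (intro bounded_linear_sub bounded_linear_ident matrix_vector_mul_bounded_linear)
  define C where "C = Blinfun (\<lambda>v. v - D *v v)"
  have C: "blinfun_apply C v = v - D *v v" for v
    unfolding C_def using bounded_linear_Blinfun_apply[OF bl] by metis
  have normC: "norm C \<le> q"
    using near q by (intro norm_blinfun_bound) (auto simp: C)
  have symC: "C u \<bullet> v = u \<bullet> C v" for u v
    using symmetric_matrix_inner[OF sym] by (simp add: C inner_diff_left inner_diff_right)
  \<comment> \<open>Self-adjointness is built into the set, so the fixed point inherits it and
    \<open>R\<close> comes out symmetric. The condition is closed, which keeps \<open>A\<close>
    complete.\<close>
  define A where "A = {Y :: (real^'m) \<Rightarrow>\<^sub>L (real^'m). norm Y \<le> q \<and> (\<forall>u v. blinfun_apply Y u \<bullet> v = u \<bullet> blinfun_apply Y v)}"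
  define F where "F Y = (1/2) *\<^sub>R (C + (Y o\<^sub>L Y))" for Y
  have "A = cball 0 q \<inter> (\<Inter>u. \<Inter>v. {Y. blinfun_apply Y u \<bullet> v = u \<bullet> blinfun_apply Y v})"
    by (auto simp: A_def)
  moreover have "closed {Y :: (real^'m) \<Rightarrow>\<^sub>L (real^'m). blinfun_apply Y u \<bullet> v = u \<bullet> blinfun_apply Y v}" for u v
    by (intro closed_Collect_eq continuous_intros)
  ultimately have "closed A"
    by (auto intro!: closed_Int closed_INT)
  then have "Topological_Spaces.complete A" by (simp add: complete_eq_closed)
  moreover have "A \<noteq> {}" using q by (auto simp: A_def intro!: exI[of _ 0])
  moreover have "F ` A \<subseteq> A"
  proof safe
    fix Y assume Y: "Y \<in> A"
    have "norm (Y o\<^sub>L Y) \<le> norm Y * norm Y" by (rule norm_blinfun_compose)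
    also have "\<dots> \<le> q * 1" using Y q by (intro mult_mono) (auto simp: A_def)
    finally have "norm (C + (Y o\<^sub>L Y)) \<le> q + q"
      using normC norm_triangle_ineq[of C "Y o\<^sub>L Y"] by linarith
    then have "norm (F Y) \<le> q" by (simp add: F_def)
    moreover have "F Y u \<bullet> v = u \<bullet> F Y v" for u v
      using Y symC by (simp add: F_def A_def blinfun.bilinear_simps inner_add_left inner_add_right)
    ultimately show "F Y \<in> A" by (simp add: A_def)
  qed
  moreover have "dist (F Y) (F Z) \<le> q * dist Y Z" if "Y \<in> A" "Z \<in> A" for Y Z
  proof -
    \<comment> \<open>\<open>Y\<close> and \<open>Z\<close> need not commute, so this telescoping
      takes the place of the product of difference and sum.\<close>
    have "(Y o\<^sub>L Y) - (Z o\<^sub>L Z) = (Y o\<^sub>L (Y - Z)) + ((Y - Z) o\<^sub>L Z)"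
      by (intro blinfun_eqI) (simp add: blinfun.bilinear_simps)
    then have "norm ((Y o\<^sub>L Y) - (Z o\<^sub>L Z)) \<le> norm Y * norm (Y - Z) + norm (Y - Z) * norm Z"
      using norm_triangle_mono[OF norm_blinfun_compose norm_blinfun_compose] by (simp only:)
    also have "\<dots> \<le> q * norm (Y - Z) + norm (Y - Z) * q"
      using that q by (intro add_mono mult_mono) (auto simp: A_def)
    finally have "norm ((Y o\<^sub>L Y) - (Z o\<^sub>L Z)) \<le> 2 * (q * norm (Y - Z))" by simp
    moreover have "F Y - F Z = (1/2) *\<^sub>R ((Y o\<^sub>L Y) - (Z o\<^sub>L Z))"
      by (simp only: F_def scaleR_diff_right[symmetric] add_diff_cancel_left)
    ultimately show ?thesis by (simp add: dist_norm)
  qed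
  ultimately obtain Y where Y: "Y \<in> A" "F Y = Y"
    using Banach_fix[of A q F] q by blast
  define R where "R = matrix (\<lambda>v. v - Y v)"
  have "bounded_linear (\<lambda>v. v - Y v)"
    by (intro bounded_linear_sub bounded_linear_ident blinfun.bounded_linear_right)
  then have R: "R *v v = v - Y v" for v
    unfolding R_def by (rule matrix_vector_mul(3)[THEN fun_cong])
  have "(transpose R *v u) \<bullet> v = (R *v u) \<bullet> v" for u v
    using Y(1) by (simp add: dot_lmul_matrix R A_def inner_diff_left inner_diff_right)
  then have "transpose R = R"
    unfolding matrix_eq by (metis vector_eq_rdot)
  moreover have "0 \<le> v \<bullet> (R *v v)" for v
  proof -
    have "norm (Y v) \<le> q * norm v"
      using Y(1) norm_blinfun[of Y v] mult_right_mono[of "norm Y" q "norm v"] by (simp add: A_def)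
    also have "\<dots> \<le> 1 * norm v" using q by (intro mult_right_mono) auto
    finally have "v \<bullet> Y v \<le> norm v * norm v"
      using norm_cauchy_schwarz[of v "Y v"] mult_left_mono[of "norm (Y v)" "norm v" "norm v"] by simp
    then show ?thesis by (simp add: R inner_diff_right dot_square_norm power2_eq_square)
  qed
  moreover have "R ** R = D"
  proof -
    \<comment> \<open>The fixed point equation doubled: 2 Y = C + Y^2, whence (I - Y)^2 = I - C =
      D.\<close>
    have "Y v + Y v = (v - D *v v) + Y (Y v)" for v
    proof -
      have "Y v = F Y v" using Y(2) by simp
      also have "\<dots> = (1/2) *\<^sub>R ((v - D *v v) + Y (Y v))"
        by (simp add: F_def blinfun.bilinear_simps C)
      finally have "2 *\<^sub>R Y v = 2 *\<^sub>R ((1/2) *\<^sub>R ((v - D *v v) + Y (Y v)))" by (rule arg_cong)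
      then show ?thesis by (simp add: scaleR_2)
    qed
    then have "R *v (R *v v) = D *v v" for v
      by (simp add: R blinfun.bilinear_simps algebra_simps)
    then show ?thesis by (simp add: matrix_eq matrix_vector_mul_assoc[symmetric])
  qed
  ultimately show ?thesis by (auto simp: pos_semidef_mat_def)
qed

text \<open>Dividing \<open>D\<close> by a large scalar \<open>s\<close> brings it near the
  identity, and the root is scaled back by \<open>sqrt s\<close>. With coercivity constant c and
  bound L, the squared distance of D/s from the identity is at most 1 - 2c/s + L^2/s^2. The choice s
  = L^2/c minimizes this, with value 1 - c^2/L^2.\<close>

lemma pos_def_sqrt_exists:
  assumes "pos_def_mat (D :: real^'m^'m)"
  shows "\<exists>R. pos_semidef_mat R \<and> R ** R = D"
proof -
  obtain c where c: "c > 0" "\<And>v. c * (norm v)\<^sup>2 \<le> v \<bullet> (D *v v)"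
    using pos_def_mat_coercive[OF assms] by blast
  \<comment> \<open>Adding \<open>c\<close> to the norm gives \<open>c \<le> L\<close> at once, so
    that the radicand in \<open>q\<close> is nonnegative.\<close>
  define L where "L = norm D + c"
  have L: "norm (D *v v) \<le> L * norm v" for v
    using norm_matrix_vector_mult_le[of D v] c(1) mult_right_mono[of "norm D" L "norm v"]
    by (simp add: L_def)
  have Lc: "0 < c" "c \<le> L" using c(1) by (auto simp: L_def)
  define s where "s = L\<^sup>2 / c"
  have s: "s > 0" using Lc by (simp add: s_def)
  define q where "q = sqrt (1 - c\<^sup>2 / L\<^sup>2)"
  have frac: "0 < c\<^sup>2 / L\<^sup>2" "c\<^sup>2 / L\<^sup>2 \<le> 1" using Lc by auto
  have q: "0 \<le> q" "q < 1" using frac by (auto simp: q_def)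
  have "norm (v - ((1/s) *\<^sub>R D) *v v) \<le> q * norm v" for v
  proof -
    have "(norm (v - (1/s) *\<^sub>R (D *v v)))\<^sup>2
        = (norm v)\<^sup>2 - 2 / s * (v \<bullet> (D *v v)) + (norm (D *v v))\<^sup>2 / s\<^sup>2"
      unfolding power2_norm_eq_inner
      by (simp add: inner_diff_left inner_diff_right inner_commute power2_eq_square)
    also have "\<dots> \<le> (norm v)\<^sup>2 - 2 / s * (c * (norm v)\<^sup>2) + (L * norm v)\<^sup>2 / s\<^sup>2"
      using s c(2)[of v] L[of v]
      by (intro add_mono diff_mono mult_left_mono divide_right_mono power_mono) auto
    also have "\<dots> = (1 - 2 * c / s + L\<^sup>2 / s\<^sup>2) * (norm v)\<^sup>2"
      by (simp add: algebra_simps power_mult_distrib)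
    also have "1 - 2 * c / s + L\<^sup>2 / s\<^sup>2 = 1 - c\<^sup>2 / L\<^sup>2"
      using Lc by (simp add: s_def field_simps power2_eq_square)
    also have "(1 - c\<^sup>2 / L\<^sup>2) * (norm v)\<^sup>2 = (q * norm v)\<^sup>2"
      using frac by (simp add: q_def power_mult_distrib)
    finally have sq: "(norm (v - (1/s) *\<^sub>R (D *v v)))\<^sup>2 \<le> (q * norm v)\<^sup>2" .
    have "norm (v - (1/s) *\<^sub>R (D *v v)) \<le> q * norm v"
      using q by (intro power2_le_imp_le[OF sq]) simp
    then show ?thesis
      by (simp add: scaleR_matrix_vector_assoc)
  qed
  moreover have "transpose ((1/s) *\<^sub>R D) = (1/s) *\<^sub>R D"
    using assms by (simp add: pos_def_mat_def transpose_scalar)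
  ultimately obtain R where R: "pos_semidef_mat R" "R ** R = (1/s) *\<^sub>R D"
    using pos_semidef_sqrt_exists_of_near_identity[of "(1/s) *\<^sub>R D" q] q by blast
  have "(sqrt s *\<^sub>R R) ** (sqrt s *\<^sub>R R) = (sqrt s * sqrt s) *\<^sub>R (R ** R)"
    by (simp add: matrix_scalar_ac scalar_matrix_assoc[symmetric])
  also have "\<dots> = D" using s by (simp add: R(2))
  finally have "(sqrt s *\<^sub>R R) ** (sqrt s *\<^sub>R R) = D" .
  moreover have "pos_semidef_mat (sqrt s *\<^sub>R R)"
    using R(1) s by (auto simp: pos_semidef_mat_def transpose_scalar scaleR_matrix_vector_assoc[symmetric])
  ultimately show ?thesis by blast
qed

text \<open>If w = R v were nonzero, moving from v to v - s w would change the form from 0 to -2 s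
  |w|^2 + s^2 b, which is negative for small positive s.\<close>

lemma pos_semidef_mat_kernel:
  assumes "pos_semidef_mat R" "v \<bullet> (R *v v) = 0"
  shows "R *v v = 0"
proof (rule ccontr)
  assume nz: "R *v v \<noteq> 0"
  define w where "w = R *v v"
  define b where "b = w \<bullet> (R *v w)"
  have w: "w \<bullet> w > 0" using nz by (simp add: w_def)
  have b: "0 \<le> b" using assms(1) by (simp add: b_def pos_semidef_mat_def)
  \<comment> \<open>The \<open>+ 1\<close> covers the case \<open>b = 0\<close> and still gives
    \<open>s * b \<le> w \<bullet> w\<close>.\<close>
  define s where "s = (w \<bullet> w) / (b + 1)"
  have s: "s > 0" using w b by (simp add: s_def)
  have "0 \<le> (v - s *\<^sub>R w) \<bullet> (R *v (v - s *\<^sub>R w))"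
    using assms(1) by (simp add: pos_semidef_mat_def)
  also have "\<dots> = s * (s * b - 2 * (w \<bullet> w))"
    using assms symmetric_matrix_inner[of R v w]
    by (simp add: pos_semidef_mat_def b_def w_def[symmetric] matrix_vector_mult_diff_distrib
        matrix_vector_mult_scaleR inner_diff_left inner_diff_right algebra_simps)
  finally have "2 * (w \<bullet> w) \<le> s * b" using s by (simp add: zero_le_mult_iff)
  moreover have "s * b \<le> w \<bullet> w"
    using b w by (simp add: s_def field_simps)
  ultimately show False using w by linarith
qed

text \<open>With \<open>Z = R - R'\<close> the equation \<open>R\<^sup>2 = R'\<^sup>2\<close> reads \<open>R Z + Z R' = 0\<close>, so that the traces of
  \<open>Z R Z\<close> and \<open>Z R' Z\<close>, both nonnegative, add up to zero.\<close>

lemma pos_semidef_sqrt_unique: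
  fixes D :: "real^'m^'m"
  assumes R: "pos_semidef_mat R" "R ** R = D" and R': "pos_semidef_mat R'" "R' ** R' = D"
    and D: "pos_def_mat D"
  shows "R = R'"
proof -
  define Z where "Z = R - R'"
  have "transpose Z = transpose R - transpose R'"
    by (simp add: Z_def transpose_def vec_eq_iff)
  then have symZ: "transpose Z = Z"
    using R R' by (simp add: Z_def pos_semidef_mat_def)
  have symZ': "Z $ i $ j = Z $ j $ i" for i j
    using arg_cong[OF symZ, of "\<lambda>A. A $ j $ i"] by (simp add: transpose_def)
  have "R ** Z + Z ** R' = 0"
    by (simp add: Z_def matrix_diff_rdistrib matrix_diff_ldistrib R R')
  then have "trace ((R ** Z + Z ** R') ** Z) = 0"
    by (simp add: trace_def)
  then have "trace ((R ** Z) ** Z) + trace ((Z ** R') ** Z) = 0"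
    by (simp add: matrix_add_rdistrib trace_add)
  moreover have "trace ((R ** Z) ** Z) = trace (Z ** (R ** Z))" by (rule trace_mul_sym)
  \<comment> \<open>Since \<open>Z\<close> is symmetric its rows are its columns, so each diagonal
    entry is the value of a quadratic form at a column.\<close>
  moreover have quad: "trace (Z ** (Q ** Z)) = (\<Sum>j\<in>UNIV. column j Z \<bullet> (Q *v column j Z))" for Q
  proof -
    have "(Z ** (Q ** Z)) $ j $ j = column j Z \<bullet> (Q *v column j Z)" for j
      by (simp add: matrix_matrix_mult_def column_def inner_vec_def matrix_vector_mult_def symZ'[of j])
    then show ?thesis by (simp add: trace_def)
  qed
  ultimately have sum0: "(\<Sum>j\<in>UNIV. column j Z \<bullet> (R *v column j Z))
      + (\<Sum>j\<in>UNIV. column j Z \<bullet> (R' *v column j Z)) = 0"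
    by (simp add: matrix_mul_assoc[symmetric])
  have nn: "column j Z \<bullet> (R *v column j Z) \<ge> 0" "column j Z \<bullet> (R' *v column j Z) \<ge> 0" for j
    using R R' by (auto simp: pos_semidef_mat_def)
  have "(\<Sum>j\<in>UNIV. column j Z \<bullet> (R *v column j Z)) = 0"
    using sum0 sum_nonneg[of UNIV "\<lambda>j. column j Z \<bullet> (R *v column j Z)"]
      sum_nonneg[of UNIV "\<lambda>j. column j Z \<bullet> (R' *v column j Z)"] nn by force
  then have "column j Z \<bullet> (R *v column j Z) = 0" for j
    using nn by (simp add: sum_nonneg_eq_0_iff)
  then have "R *v column j Z = 0" for j
    using pos_semidef_mat_kernel R(1) by blast
  then have "D *v column j Z = 0" for j
    by (simp add: R(2)[symmetric] matrix_vector_mul_assoc[symmetric])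
  then have "column j Z = 0" for j
    using D by (metis inner_zero_right less_irrefl pos_def_mat_def)
  then have "Z = 0" by (simp add: column_def vec_eq_iff)
  then show ?thesis by (simp add: Z_def)
qed

text \<open>\<open>mat_sqrt\<close> is a definite description and yields its defining property only
  after existence and uniqueness are known. A vector killed by the root is killed by
  \<open>D\<close>, so the root is invertible.\<close>

lemma mat_sqrt_mult_mat_inv_sqrt:
  assumes "pos_def_mat D"
  shows "mat_sqrt D ** mat_inv_sqrt D = mat 1"
proof -
  have "\<exists>!R. pos_semidef_mat R \<and> R ** R = D"
    using pos_def_sqrt_exists pos_semidef_sqrt_unique assms by blast
  from theI'[OF this] have sq: "mat_sqrt D ** mat_sqrt D = D"
    by (simp add: mat_sqrt_def)
  have "v = 0" if "mat_sqrt D *v v = 0" for v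
  proof -
    have "D *v v = mat_sqrt D *v (mat_sqrt D *v v)"
      by (simp add: sq matrix_vector_mul_assoc)
    with that have "D *v v = 0" by simp
    then show ?thesis
      using assms by (metis inner_zero_right less_irrefl pos_def_mat_def)
  qed
  then have "invertible (mat_sqrt D)"
    by (metis invertible_left_inverse matrix_left_invertible_ker)
  then show ?thesis
    unfolding mat_inv_sqrt_def by (rule invertible_matrix_inv)
qed

section \<open>Deterministic error bound for one Newton step\<close>

text \<open>In the application \<open>B\<close> is the derivative sum at the estimate,
  \<open>H\<close> the derivative sum averaged along the segment, \<open>s\<close> the score at the
  true value and \<open>\<Delta>\<close> the estimation error, so \<open>s + H *v \<Delta>\<close>
  is the score at the estimate. With N = J B^(-1), the inverse of the near-identity matrix B J^(-1),
  the new error satisfies J(...) = N (B - H) \<Delta> - N s. The constant \<open>k\<close> appears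
  because the Euclidean norm of the identity is not 1 in general.\<close>

lemma newton_step_error:
  fixes A L J B H :: "real^'m^'m" and s \<Delta> :: "real^'m"
  assumes LA: "L ** A = mat 1" and J: "invertible J"
    and B: "norm (B ** matrix_inv J - mat 1) \<le> \<delta>" and \<delta>: "\<delta> \<le> 1/2"
    and H: "norm ((B - H) ** matrix_inv J) \<le> \<kappa>"
  defines "k \<equiv> norm (mat 1 :: real^'m^'m)"
  shows "invertible B"
    and "norm (A *v (J *v (\<Delta> - matrix_inv B *v (s + H *v \<Delta>))) + A *v s)
       \<le> 2 * k * (\<delta> * (norm L * norm A) * norm (A *v s) + norm A * norm J * norm \<Delta> * \<kappa>)"
proof -
  define K where "K = matrix_inv J"
  define Q where "Q = B ** K"
  have JK: "J ** K = mat 1" "K ** J = mat 1"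
    unfolding K_def using invertible_matrix_inv[OF J] by auto
  have Q1: "norm (Q - mat 1) \<le> \<delta>" using B by (simp add: Q_def K_def)
  have "v = 0" if "Q *v v = 0" for v
  proof -
    have "norm v = norm ((Q - mat 1) *v v)"
      using that by (simp add: matrix_vector_mult_diff_rdistrib)
    also have "\<dots> \<le> 1/2 * norm v"
      using norm_matrix_vector_mult_le[of "Q - mat 1" v] Q1 \<delta>
        mult_right_mono[of "norm (Q - mat 1)" "1/2" "norm v"] by simp
    finally show ?thesis by simp
  qed
  then have invQ: "invertible Q"
    by (metis invertible_left_inverse matrix_left_invertible_ker)
  have BQ: "B = Q ** J" by (simp add: Q_def matrix_mul_assoc[symmetric] JK)
  then show invB: "invertible B" using invQ J by (simp add: invertible_mult)
  define N where "N = J ** matrix_inv B"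
  have NQ: "N ** Q = mat 1"
  proof -
    have "N ** Q = J ** (matrix_inv B ** B) ** K"
      by (simp add: N_def Q_def matrix_mul_assoc)
    then show ?thesis by (simp add: invertible_matrix_inv[OF invB] JK)
  qed
  \<comment> \<open>\<open>norm N\<close> occurs on both sides of the resulting estimate. As
    \<open>\<delta> \<le> 1/2\<close>, half of it is absorbed, which leaves
    \<open>norm N \<le> 2 * k\<close>.\<close>
  have "N - mat 1 = - (N ** (Q - mat 1))"
    by (simp add: matrix_diff_ldistrib NQ)
  then have N1: "norm (N - mat 1) \<le> norm N * \<delta>"
    using norm_matrix_matrix_mult_le[of N "Q - mat 1"] mult_left_mono[OF Q1, of "norm N"] by simp
  also have "\<dots> \<le> norm N * (1/2)" using \<delta> by (intro mult_left_mono) auto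
  finally have N: "norm N \<le> 2 * k"
    using norm_triangle_sub[of N "mat 1"] unfolding k_def by simp
  have \<delta>0: "0 \<le> \<delta>" using order_trans[OF norm_ge_zero Q1] .
  have N1': "norm (N - mat 1) \<le> 2 * k * \<delta>"
    using N1 mult_right_mono[OF N \<delta>0] by linarith
  have "J *v (\<Delta> - matrix_inv B *v (s + H *v \<Delta>)) = N *v (B *v \<Delta>) - N *v (s + H *v \<Delta>)"
    by (simp add: N_def matrix_vector_mult_diff_distrib matrix_vector_mul_assoc
        matrix_mul_assoc[symmetric] invertible_matrix_inv[OF invB])
  also have "\<dots> = N *v ((B - H) *v \<Delta>) - N *v s"
    by (simp add: matrix_vector_mult_diff_rdistrib matrix_vector_mult_diff_distrib
        matrix_vector_right_distrib)
  \<comment> \<open>\<open>K ** J\<close> is inserted so that \<open>B - H\<close> appears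
    normalized. Next, \<open>L ** A\<close> is inserted before \<open>s\<close> so that the error is
    measured by \<open>A *v s\<close>; this produces the factor
    \<open>norm L * norm A\<close>.\<close>
  also have "(B - H) *v \<Delta> = ((B - H) ** K) *v (J *v \<Delta>)"
    by (simp add: matrix_vector_mul_assoc matrix_mul_assoc[symmetric] JK)
  also have "N *v s = s + (N - mat 1) *v (L *v (A *v s))"
    by (simp add: matrix_vector_mul_assoc LA matrix_vector_mult_diff_rdistrib)
  finally have "A *v (J *v (\<Delta> - matrix_inv B *v (s + H *v \<Delta>))) + A *v s
     = A *v (N *v (((B - H) ** K) *v (J *v \<Delta>))) - A *v ((N - mat 1) *v (L *v (A *v s)))"
    by (simp add: matrix_vector_mult_diff_distrib matrix_vector_right_distrib)
  also have "norm \<dots> \<le> norm (A *v (N *v (((B - H) ** K) *v (J *v \<Delta>))))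
      + norm (A *v ((N - mat 1) *v (L *v (A *v s))))"
    by (rule norm_triangle_ineq4)
  also have "\<dots> \<le> norm A * (2 * k * (\<kappa> * (norm J * norm \<Delta>)))
      + norm A * (2 * k * \<delta> * (norm L * norm (A *v s)))"
  proof (rule add_mono)
    have "norm (((B - H) ** K) *v (J *v \<Delta>)) \<le> \<kappa> * (norm J * norm \<Delta>)"
      using H order_trans[OF norm_ge_zero H]
      by (intro order_trans[OF norm_matrix_vector_mult_le] mult_mono norm_matrix_vector_mult_le)
        (auto simp: K_def)
    then have "norm (N *v (((B - H) ** K) *v (J *v \<Delta>))) \<le> 2 * k * (\<kappa> * (norm J * norm \<Delta>))"
      using N by (intro order_trans[OF norm_matrix_vector_mult_le[of N]] mult_mono) (auto simp: k_def)
    then show "norm (A *v (N *v (((B - H) ** K) *v (J *v \<Delta>))))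
        \<le> norm A * (2 * k * (\<kappa> * (norm J * norm \<Delta>)))"
      by (intro order_trans[OF norm_matrix_vector_mult_le[of A]] mult_left_mono) auto
    have "norm ((N - mat 1) *v (L *v (A *v s))) \<le> 2 * k * \<delta> * (norm L * norm (A *v s))"
      using N1' order_trans[OF norm_ge_zero N1']
      by (intro order_trans[OF norm_matrix_vector_mult_le[of "N - mat 1"]] mult_mono
          norm_matrix_vector_mult_le) auto
    then show "norm (A *v ((N - mat 1) *v (L *v (A *v s))))
        \<le> norm A * (2 * k * \<delta> * (norm L * norm (A *v s)))"
      by (intro order_trans[OF norm_matrix_vector_mult_le[of A]] mult_left_mono) auto
  qed
  finally show "norm (A *v (J *v (\<Delta> - matrix_inv B *v (s + H *v \<Delta>))) + A *v s)
       \<le> 2 * k * (\<delta> * (norm L * norm A) * norm (A *v s) + norm A * norm J * norm \<Delta> * \<kappa>)"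
    by (simp add: algebra_simps)
qed

lemma bounded_linear_matrix_vector_mult_left: "bounded_linear (\<lambda>B. B *v (x :: real^'n) :: real^'m)"
  by (rule bounded_linear_intro[where K = "norm x"])
    (auto simp: matrix_vector_mult_add_rdistrib norm_matrix_vector_mult_le
      scaleR_matrix_vector_assoc)

text \<open>Here the sample is fixed. Both \<open>m' i t\<close> and the average over the segment
  differ from \<open>m' i \<theta>\<close>, after normalization, by at most \<open>T i\<close>,
  because the whole segment lies in the ball on which \<open>T i\<close> controls the oscillation.
  The comparison between the two goes through \<open>\<theta>\<close>, hence the factor 2.\<close>

lemma one_step_error:
  fixes L A J :: "real^'m^'m" and m :: "'i \<Rightarrow> real^'m \<Rightarrow> real^'m" and m' :: "'i \<Rightarrow> real^'m \<Rightarrow> real^'m^'m"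
  assumes LA: "L ** A = mat 1" and J: "invertible J"
    and incr: "\<And>i. i \<in> I \<Longrightarrow> (\<lambda>v. m' i (\<theta> + v *\<^sub>R (t - \<theta>))) integrable_on {0..1} \<and>
      m i t - m i \<theta> = integral {0..1} (\<lambda>v. m' i (\<theta> + v *\<^sub>R (t - \<theta>))) *v (t - \<theta>)"
    and osc: "\<And>i u. i \<in> I \<Longrightarrow> u \<in> cball \<theta> (norm (t - \<theta>)) \<Longrightarrow>
      norm ((m' i u - m' i \<theta>) ** matrix_inv J) \<le> T i"
    and \<delta>: "norm ((\<Sum>i\<in>I. m' i \<theta>) ** matrix_inv J - mat 1) + (\<Sum>i\<in>I. T i) \<le> \<delta>" "\<delta> \<le> 1/2"
  shows "invertible (\<Sum>i\<in>I. m' i t)"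
    and "norm (A *v (J *v (t - matrix_inv (\<Sum>i\<in>I. m' i t) *v (\<Sum>i\<in>I. m i t) - \<theta>))
          + A *v (\<Sum>i\<in>I. m i \<theta>))
       \<le> 2 * norm (mat 1 :: real^'m^'m) * (\<delta> * (norm L * norm A) * norm (A *v (\<Sum>i\<in>I. m i \<theta>))
          + norm A * norm J * norm (t - \<theta>) * (2 * (\<Sum>i\<in>I. T i)))"
proof -
  define K where "K = matrix_inv J"
  define h where "h i = integral {0..1} (\<lambda>v. m' i (\<theta> + v *\<^sub>R (t - \<theta>)))" for i
  define H where "H = (\<Sum>i\<in>I. h i)"
  define B where "B = (\<Sum>i\<in>I. m' i t)"
  interpret bl: bounded_linear "\<lambda>C. C ** K"
    by (rule bounded_linear_matrix_mult_right)
  have BT: "norm ((B - (\<Sum>i\<in>I. m' i \<theta>)) ** K) \<le> (\<Sum>i\<in>I. T i)"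
  proof -
    have "(B - (\<Sum>i\<in>I. m' i \<theta>)) ** K = (\<Sum>i\<in>I. (m' i t - m' i \<theta>) ** K)"
      by (simp add: B_def sum_subtractf[symmetric] bl.sum)
    also have "norm \<dots> \<le> (\<Sum>i\<in>I. T i)"
      by (rule sum_norm_le) (auto simp: K_def dist_norm norm_minus_commute intro!: osc)
    finally show ?thesis .
  qed
  have HT: "norm ((H - (\<Sum>i\<in>I. m' i \<theta>)) ** K) \<le> (\<Sum>i\<in>I. T i)"
  proof -
    have "norm ((h i - m' i \<theta>) ** K) \<le> T i" if i: "i \<in> I" for i
    proof -
      \<comment> \<open>The integral is a gauge integral, so the bound is taken inside it:
        subtracting a constant and applying a bounded linear map keep \<open>has_integral\<close>,
        and a pointwise bound passes to the value.\<close>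
      have "((\<lambda>v. m' i (\<theta> + v *\<^sub>R (t - \<theta>)) - m' i \<theta>) has_integral (h i - m' i \<theta>)) {0..1}"
        using incr[OF i] has_integral_const_real[of "m' i \<theta>" 0 1]
        by (intro has_integral_diff) (auto simp: h_def)
      from has_integral_linear[OF this bl.bounded_linear_axioms]
      have "((\<lambda>v. (m' i (\<theta> + v *\<^sub>R (t - \<theta>)) - m' i \<theta>) ** K) has_integral ((h i - m' i \<theta>) ** K)) {0..1}"
        by (simp add: o_def)
      moreover have "norm ((m' i (\<theta> + v *\<^sub>R (t - \<theta>)) - m' i \<theta>) ** K) \<le> T i" if "v \<in> {0..1}" for v
        unfolding K_def using that i
        by (intro osc) (auto simp: dist_norm mult_left_le_one_le)
      moreover have "0 \<le> T i" using order_trans[OF norm_ge_zero osc[OF i, of \<theta>]] by simp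
      ultimately show ?thesis
        using has_integral_bound[of "T i" "\<lambda>v. (m' i (\<theta> + v *\<^sub>R (t - \<theta>)) - m' i \<theta>) ** K"
            "(h i - m' i \<theta>) ** K" 0 1] by simp
    qed
    then show ?thesis
      by (auto simp: H_def sum_subtractf[symmetric] bl.sum intro!: sum_norm_le)
  qed
  have e: "B ** K - mat 1 = (B - (\<Sum>i\<in>I. m' i \<theta>)) ** K + ((\<Sum>i\<in>I. m' i \<theta>) ** K - mat 1)"
    by (simp add: bl.diff)
  have 1: "norm (B ** K - mat 1) \<le> \<delta>"
    using norm_triangle_mono[OF BT order_refl, of "(\<Sum>i\<in>I. m' i \<theta>) ** K - mat 1"] \<delta>(1)
    by (simp only: e K_def[symmetric])
  have "(B - H) ** K = (B - (\<Sum>i\<in>I. m' i \<theta>)) ** K - (H - (\<Sum>i\<in>I. m' i \<theta>)) ** K"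
    by (simp add: bl.diff)
  then have 2: "norm ((B - H) ** K) \<le> 2 * (\<Sum>i\<in>I. T i)"
    using norm_triangle_le_diff[OF add_mono[OF BT HT]] by simp
  note step = newton_step_error[OF LA J 1[unfolded K_def] \<delta>(2) 2[unfolded K_def]]
  show "invertible (\<Sum>i\<in>I. m' i t)" using step(1) by (simp add: B_def)
  have "(\<Sum>i\<in>I. m i t) - (\<Sum>i\<in>I. m i \<theta>) = H *v (t - \<theta>)"
    using incr by (simp add: sum_subtractf[symmetric] H_def h_def linear_sum[OF bounded_linear.linear[OF bounded_linear_matrix_vector_mult_left]])
  then have "(\<Sum>i\<in>I. m i t) = (\<Sum>i\<in>I. m i \<theta>) + H *v (t - \<theta>)" by (simp add: algebra_simps)
  then show "norm (A *v (J *v (t - matrix_inv (\<Sum>i\<in>I. m' i t) *v (\<Sum>i\<in>I. m i t) - \<theta>))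
          + A *v (\<Sum>i\<in>I. m i \<theta>))
       \<le> 2 * norm (mat 1 :: real^'m^'m) * (\<delta> * (norm L * norm A) * norm (A *v (\<Sum>i\<in>I. m i \<theta>))
          + norm A * norm J * norm (t - \<theta>) * (2 * (\<Sum>i\<in>I. T i)))"
    using step(2)[of "t - \<theta>" "\<Sum>i\<in>I. m i \<theta>"]
    by (simp add: B_def cancel_ab_semigroup_add_class.diff_right_commute[of t \<theta>])
qed

section \<open>Measurability of determinants and of solutions of linear systems\<close>

lemma borel_measurable_det:
  fixes B :: "'a \<Rightarrow> real^'m^'m"
  assumes "\<And>i j. (\<lambda>x. B x $ i $ j) \<in> borel_measurable N"
  shows "(\<lambda>x. det (B x)) \<in> borel_measurable N"
  unfolding det_def
  by (rule borel_measurable_sum,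
      rule borel_measurable_times[OF borel_measurable_const borel_measurable_prod[OF assms]])

lemma borel_measurable_vecI:
  fixes f :: "'a \<Rightarrow> real^'m"
  assumes "\<And>i. (\<lambda>x. f x $ i) \<in> borel_measurable N"
  shows "f \<in> borel_measurable N"
proof -
  have "f = (\<lambda>x. \<Sum>i\<in>UNIV. f x $ i *\<^sub>R axis i 1)"
    by (rule ext) (simp only: basis_expansion[where 'a = real, unfolded scalar_mult_eq_scaleR])
  also have "\<dots> \<in> borel_measurable N"
    by (rule borel_measurable_sum, rule borel_measurable_scaleR[OF assms borel_measurable_const])
  finally show ?thesis .
qed

lemma borel_measurable_mat_entry:
  fixes f :: "'a \<Rightarrow> real^'n^'m"
  assumes "f \<in> borel_measurable N"
  shows "(\<lambda>x. f x $ i $ j) \<in> borel_measurable N"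
  by (rule borel_measurable_continuous_on[of "\<lambda>A. A $ i $ j", OF _ assms])
    (rule continuous_on_component[OF continuous_on_component[OF continuous_on_id]])

text \<open>Cramer's rule writes the solution as quotients of determinants, which are polynomials in
  measurable entries. Measurability of \<open>matrix_inv\<close>, a choice term, is never addressed
  directly.\<close>

lemma borel_measurable_matrix_inv_mult:
  fixes B :: "'a \<Rightarrow> real^'m^'m" and b c :: "'a \<Rightarrow> real^'m"
  assumes B: "B \<in> borel_measurable N" and b: "b \<in> borel_measurable N" and c: "c \<in> borel_measurable N"
  shows "(\<lambda>x. if invertible (B x) then matrix_inv (B x) *v b x else c x) \<in> borel_measurable N"
proof -
  note m = borel_measurable_mat_entry[OF B] measurable_compose[OF b borel_measurable_nth]
  have det: "(\<lambda>x. det (B x)) \<in> borel_measurable N"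
    by (intro borel_measurable_det m)
  have *: "(\<lambda>x. det (\<chi> i j. if j = k then b x $ i else B x $ i $ j)) \<in> borel_measurable N" for k
  proof (rule borel_measurable_det)
    fix i j
    show "(\<lambda>x. (\<chi> i j. if j = k then b x $ i else B x $ i $ j) $ i $ j) \<in> borel_measurable N"
      by (cases "j = k") (simp_all add: m)
  qed
  have "matrix_inv (B x) *v b x = (\<chi> k. det (\<chi> i j. if j = k then b x $ i else B x $ i $ j) / det (B x))"
    if "det (B x) \<noteq> 0" for x
    using cramer[OF that, of "matrix_inv (B x) *v b x" "b x"] that
    by (simp add: matrix_vector_mul_assoc invertible_matrix_inv invertible_det_nz)
  then have "(\<lambda>x. if invertible (B x) then matrix_inv (B x) *v b x else c x) =
     (\<lambda>x. if det (B x) \<noteq> 0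
        then (\<chi> k. det (\<chi> i j. if j = k then b x $ i else B x $ i $ j) / det (B x)) else c x)"
    by (auto simp: invertible_det_nz)
  also have "\<dots> \<in> borel_measurable N"
  proof (rule measurable_If)
    show "(\<lambda>x. \<chi> k. det (\<chi> i j. if j = k then b x $ i else B x $ i $ j) / det (B x)) \<in> borel_measurable N"
      by (rule borel_measurable_vecI) (simp only: vec_lambda_beta borel_measurable_divide[OF * det])
    show "{x \<in> space N. det (B x) \<noteq> 0} \<in> sets N"
      using measurable_sets[OF det, of "- {0}"] by (simp add: vimage_def Int_def conj_commute)
  qed (fact c)
  finally show ?thesis .
qed

section \<open>Events of high inner probability\<close>

text \<open>The event \<open>Q n\<close> itself need not be measurable, so its inner probability is used.\<close>

definition with_high_prob :: "(nat \<Rightarrow> 'w measure) \<Rightarrow> (nat \<Rightarrow> 'w \<Rightarrow> bool) \<Rightarrow> bool" where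
  "with_high_prob P Q \<longleftrightarrow> (\<forall>\<eta>>0. \<forall>\<^sub>F n in sequentially.
     \<exists>G\<in>sets (P n). 1 - \<eta> \<le> measure (P n) G \<and> (\<forall>\<omega>\<in>G. Q n \<omega>))"

lemma (in prob_space) prob_Int_ge:
  assumes "A \<in> events" "B \<in> events" "1 - a \<le> prob A" "1 - b \<le> prob B"
  shows "1 - (a + b) \<le> prob (A \<inter> B)"
proof -
  have "prob (A \<inter> B) = prob A + prob B - prob (A \<union> B)"
    using finite_measure_Union'[of A B] finite_measure_Diff'[of B A] assms
    by (simp add: Int_commute)
  then show ?thesis using assms prob_le_1[of "A \<union> B"] by linarith
qed

lemma with_high_prob_conj:
  assumes P: "\<And>n. prob_space (P n)" and Q: "with_high_prob P Q" and R: "with_high_prob P R"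
  shows "with_high_prob P (\<lambda>n \<omega>. Q n \<omega> \<and> R n \<omega>)"
  unfolding with_high_prob_def
proof (intro allI impI)
  fix \<eta> :: real assume "\<eta> > 0"
  then have "\<eta> / 2 > 0" by simp
  from Q[unfolded with_high_prob_def, rule_format, OF this]
    R[unfolded with_high_prob_def, rule_format, OF this]
  show "\<forall>\<^sub>F n in sequentially. \<exists>G\<in>sets (P n). 1 - \<eta> \<le> measure (P n) G \<and> (\<forall>\<omega>\<in>G. Q n \<omega> \<and> R n \<omega>)"
  proof eventually_elim
    case (elim n)
    then obtain A B where A: "A \<in> sets (P n)" "1 - \<eta> / 2 \<le> measure (P n) A" "\<forall>\<omega>\<in>A. Q n \<omega>"
      and B: "B \<in> sets (P n)" "1 - \<eta> / 2 \<le> measure (P n) B" "\<forall>\<omega>\<in>B. R n \<omega>" by blast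
    have "1 - (\<eta> / 2 + \<eta> / 2) \<le> measure (P n) (A \<inter> B)"
      using prob_space.prob_Int_ge[OF P A(1) B(1) A(2) B(2)] .
    then show ?case using A B by (intro bexI[of _ "A \<inter> B"]) auto
  qed
qed

lemma with_high_prob_mono:
  assumes Q: "with_high_prob P Q"
    and imp: "\<forall>\<^sub>F n in sequentially. \<forall>\<omega>\<in>space (P n). Q n \<omega> \<longrightarrow> R n \<omega>"
  shows "with_high_prob P R"
  unfolding with_high_prob_def
proof (intro allI impI)
  fix \<eta> :: real assume "\<eta> > 0"
  from Q[unfolded with_high_prob_def, rule_format, OF this] imp
  show "\<forall>\<^sub>F n in sequentially. \<exists>G\<in>sets (P n). 1 - \<eta> \<le> measure (P n) G \<and> (\<forall>\<omega>\<in>G. R n \<omega>)"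
  proof eventually_elim
    case (elim n)
    then obtain A where "A \<in> sets (P n)" "1 - \<eta> \<le> measure (P n) A" "\<forall>\<omega>\<in>A. Q n \<omega>" by blast
    with elim(2) show ?case by (intro bexI[of _ A]) (auto dest: sets.sets_into_space)
  qed
qed

lemma with_high_prob_AE:
  assumes P: "\<And>n. prob_space (P n)" and Q: "\<And>n. AE \<omega> in P n. Q n \<omega>"
  shows "with_high_prob P Q"
  unfolding with_high_prob_def
proof (intro allI impI always_eventually)
  fix \<eta> :: real and n assume \<eta>: "\<eta> > 0"
  interpret prob_space "P n" by (rule P)
  from AE_E[OF Q[of n]] obtain N where N: "{\<omega> \<in> space (P n). \<not> Q n \<omega>} \<subseteq> N"
    "emeasure (P n) N = 0" "N \<in> sets (P n)" .
  then have "prob (space (P n) - N) = 1"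
    by (subst prob_compl) (auto simp: measure_def)
  then show "\<exists>G\<in>sets (P n). 1 - \<eta> \<le> measure (P n) G \<and> (\<forall>\<omega>\<in>G. Q n \<omega>)"
    using N \<eta> by (intro bexI[of _ "space (P n) - N"]) auto
qed

lemma tendsto_prob_1_of_with_high_prob:
  assumes P: "\<And>n. prob_space (P n)" and Q: "with_high_prob P Q"
    and meas: "\<And>n. {\<omega> \<in> space (P n). Q n \<omega>} \<in> sets (P n)"
  shows "(\<lambda>n. measure (P n) {\<omega> \<in> space (P n). Q n \<omega>}) \<longlonglongrightarrow> 1"
proof (rule tendstoI)
  fix \<eta> :: real assume "\<eta> > 0"
  then have "\<eta> / 2 > 0" by simp
  from Q[unfolded with_high_prob_def, rule_format, OF this]
  show "\<forall>\<^sub>F n in sequentially. dist (measure (P n) {\<omega> \<in> space (P n). Q n \<omega>}) 1 < \<eta>"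
  proof eventually_elim
    case (elim n)
    interpret prob_space "P n" by (rule P)
    from elim obtain G where G: "G \<in> events" "1 - \<eta> / 2 \<le> prob G" "\<forall>\<omega>\<in>G. Q n \<omega>" by blast
    then have "prob G \<le> prob {\<omega> \<in> space (P n). Q n \<omega>}"
      by (intro finite_measure_mono meas) (auto dest: sets.sets_into_space)
    then show ?case using G(2) prob_le_1[of "{\<omega> \<in> space (P n). Q n \<omega>}"] \<open>\<eta> > 0\<close>
      unfolding dist_real_def by linarith
  qed
qed

lemma with_high_prob_of_tendsto_0:
  assumes P: "\<And>n. prob_space (P n)"
    and lim: "(\<lambda>n. measure (P n) {\<omega> \<in> space (P n). \<not> Q n \<omega>}) \<longlonglongrightarrow> 0"
    and meas: "\<forall>\<^sub>F n in sequentially. {\<omega> \<in> space (P n). Q n \<omega>} \<in> sets (P n)"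
  shows "with_high_prob P Q"
  unfolding with_high_prob_def
proof (intro allI impI)
  fix \<eta> :: real assume "\<eta> > 0"
  from order_tendstoD(2)[OF lim this] meas
  show "\<forall>\<^sub>F n in sequentially. \<exists>G\<in>sets (P n). 1 - \<eta> \<le> measure (P n) G \<and> (\<forall>\<omega>\<in>G. Q n \<omega>)"
  proof eventually_elim
    case (elim n)
    interpret prob_space "P n" by (rule P)
    have "{\<omega> \<in> space (P n). \<not> Q n \<omega>} = space (P n) - {\<omega> \<in> space (P n). Q n \<omega>}" by auto
    then have "prob {\<omega> \<in> space (P n). \<not> Q n \<omega>} = 1 - prob {\<omega> \<in> space (P n). Q n \<omega>}"
      using elim(2) by (simp add: prob_compl)
    then show ?case using elim by (intro bexI[of _ "{\<omega> \<in> space (P n). Q n \<omega>}"]) auto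
  qed
qed

lemma with_high_prob_of_converges_in_prob:
  fixes Y :: "nat \<Rightarrow> 'w \<Rightarrow> 'b::{metric_space, second_countable_topology}"
  assumes P: "\<And>n. prob_space (P n)" and Y: "converges_in_prob P Y c"
    and meas: "\<And>n. Y n \<in> borel_measurable (P n)" and \<epsilon>: "\<epsilon> > 0"
  shows "with_high_prob P (\<lambda>n \<omega>. dist (Y n \<omega>) c \<le> \<epsilon>)"
proof (rule with_high_prob_of_tendsto_0[OF P])
  show "(\<lambda>n. measure (P n) {\<omega> \<in> space (P n). \<not> dist (Y n \<omega>) c \<le> \<epsilon>}) \<longlonglongrightarrow> 0"
    using Y \<epsilon> by (simp add: converges_in_prob_def not_le)
  show "\<forall>\<^sub>F n in sequentially. {\<omega> \<in> space (P n). dist (Y n \<omega>) c \<le> \<epsilon>} \<in> sets (P n)"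
  proof (rule always_eventually, rule allI)
    fix n
    note [measurable] = meas[of n]
    show "{\<omega> \<in> space (P n). dist (Y n \<omega>) c \<le> \<epsilon>} \<in> sets (P n)" by measurable
  qed
qed

section \<open>Markov's inequality and evaluation at a random radius\<close>

text \<open>Markov's inequality for the complement, stated on the extended half-line because
  \<open>u\<close> will be a sum of \<open>tau\<close> values, possibly infinite.\<close>

lemma (in prob_space) prob_gt_le_of_nn_integral_le:
  assumes u [measurable]: "u \<in> borel_measurable M" and int: "(\<integral>\<^sup>+\<omega>. u \<omega> \<partial>M) \<le> ennreal (\<epsilon> * \<eta>)"
    and \<epsilon>: "\<epsilon> > 0" "\<eta> \<ge> 0"
  shows "1 - \<eta> \<le> prob {\<omega> \<in> space M. u \<omega> \<le> ennreal \<epsilon>}"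
proof -
  have "emeasure M {\<omega> \<in> space M. 1 \<le> ennreal (1/\<epsilon>) * u \<omega>} \<le> ennreal (1/\<epsilon>) * (\<integral>\<^sup>+\<omega>. u \<omega> * indicator (space M) \<omega> \<partial>M)"
    by (rule nn_integral_Markov_inequality) measurable
  also have "(\<integral>\<^sup>+\<omega>. u \<omega> * indicator (space M) \<omega> \<partial>M) = (\<integral>\<^sup>+\<omega>. u \<omega> \<partial>M)"
    by (rule nn_integral_cong) simp
  also have "ennreal (1/\<epsilon>) * (\<integral>\<^sup>+\<omega>. u \<omega> \<partial>M) \<le> ennreal (1/\<epsilon>) * ennreal (\<epsilon> * \<eta>)"
    using int by (rule mult_left_mono) simp
  also have "\<dots> = ennreal \<eta>" using \<epsilon> by (simp add: ennreal_mult'[symmetric])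
  finally have 1: "prob {\<omega> \<in> space M. 1 \<le> ennreal (1/\<epsilon>) * u \<omega>} \<le> \<eta>"
    using \<epsilon> by (simp add: emeasure_eq_measure)
  have "1 \<le> ennreal (1/\<epsilon>) * u \<omega>" if "ennreal \<epsilon> < u \<omega>" for \<omega>
  proof -
    have "1 = ennreal (1/\<epsilon>) * ennreal \<epsilon>" using \<epsilon> by (simp add: ennreal_mult'[symmetric])
    also have "\<dots> \<le> ennreal (1/\<epsilon>) * u \<omega>" using that by (intro mult_left_mono) auto
    finally show ?thesis .
  qed
  then have "prob (space M - {\<omega> \<in> space M. u \<omega> \<le> ennreal \<epsilon>}) \<le> prob {\<omega> \<in> space M. 1 \<le> ennreal (1/\<epsilon>) * u \<omega>}"
    by (intro finite_measure_mono) (auto simp: not_le)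
  then show ?thesis using 1 by (subst (asm) prob_compl) auto
qed

text \<open>The law of \<open>R\<close> is inner regular on the interval where \<open>q\<close> holds, and the largest element of a
  compact subset of nearly full mass is the wanted radius.\<close>

lemma (in prob_space) deterministic_radius:
  fixes R :: "'a \<Rightarrow> real"
  assumes R [measurable]: "R \<in> borel_measurable M" and R0: "\<And>\<omega>. 0 \<le> R \<omega>"
    and q0: "q 0" and q: "\<And>r s. 0 \<le> r \<Longrightarrow> r \<le> s \<Longrightarrow> q s \<Longrightarrow> q r" and \<eta>: "\<eta> > 0"
  obtains r where "0 \<le> r" "q r" "prob {\<omega> \<in> space M. q (R \<omega>)} - \<eta> \<le> prob {\<omega> \<in> space M. R \<omega> \<le> r}"
    "{\<omega> \<in> space M. q (R \<omega>)} \<in> events"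
proof -
  define B where "B = {r. 0 \<le> r \<and> q r}"
  \<comment> \<open>\<open>q\<close> is an arbitrary predicate, but it is closed downwards, so
    \<open>B\<close> is an interval and hence Borel.\<close>
  have B: "B \<in> sets borel"
    by (rule real_interval_borel_measurable) (auto simp: B_def is_interval_1 intro: q)
  have preB: "R -` B \<inter> space M = {\<omega> \<in> space M. q (R \<omega>)}" using R0 by (auto simp: B_def)
  interpret D: prob_space "distr M borel R" by (rule prob_space_distr) fact
  have D: "D.prob A = prob (R -` A \<inter> space M)" if "A \<in> sets borel" for A
    using that by (simp add: measure_distr)
  have "\<exists>K. K \<subseteq> B \<and> compact K \<and> D.prob B - \<eta> \<le> D.prob K"
  proof (rule ccontr)
    assume *: "\<not> ?thesis"
    have "emeasure (distr M borel R) B = (SUP K \<in> {K. K \<subseteq> B \<and> compact K}. emeasure (distr M borel R) K)"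
      by (rule inner_regular) (auto simp: B D.emeasure_eq_measure)
    \<comment> \<open>The truncation keeps the real bound nonnegative, so that the inequality can be
      carried back from \<open>ennreal\<close> to the reals.\<close>
    also have "\<dots> \<le> ennreal (max 0 (D.prob B - \<eta>))"
    proof (rule SUP_least)
      fix K assume "K \<in> {K. K \<subseteq> B \<and> compact K}"
      then have "D.prob K \<le> D.prob B - \<eta>" using * by force
      then show "emeasure (distr M borel R) K \<le> ennreal (max 0 (D.prob B - \<eta>))"
        by (auto simp: D.emeasure_eq_measure intro: ennreal_leI)
    qed
    finally have "D.prob B \<le> max 0 (D.prob B - \<eta>)"
      unfolding D.emeasure_eq_measure by (subst (asm) ennreal_le_iff) auto
    then have "D.prob B \<le> \<eta>" using \<eta> by linarith
    \<comment> \<open>The empty set is an admissible compact set, so the assumed failure also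
      excludes \<open>D.prob B \<le> \<eta>\<close>.\<close>
    moreover have "\<not> D.prob B - \<eta> \<le> 0" using *[simplified, rule_format, of "{}"] by simp
    ultimately show False by simp
  qed
  then obtain K where K: "K \<subseteq> B" "compact K" "D.prob B - \<eta> \<le> D.prob K" by blast
  \<comment> \<open>A nonempty \<open>K\<close> contains its maximum, so \<open>q\<close> holds
    there; for empty \<open>K\<close> the radius 0 serves, by \<open>q0\<close>.\<close>
  have "\<exists>r\<ge>0. q r \<and> K \<subseteq> {..r}"
  proof (cases "K = {}")
    case False
    from compact_attains_sup[OF K(2) this] obtain r where "r \<in> K" "\<forall>t\<in>K. t \<le> r" by blast
    then show ?thesis using K(1) by (intro exI[of _ r]) (auto simp: B_def)
  qed (use q0 in auto)
  then obtain r where r: "0 \<le> r" "q r" "K \<subseteq> {..r}" by blast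
  have "D.prob K \<le> D.prob {..r}"
    using r(3) by (intro D.finite_measure_mono) auto
  also have "\<dots> = prob {\<omega> \<in> space M. R \<omega> \<le> r}"
    by (simp add: D vimage_def Int_def conj_commute)
  finally have "prob {\<omega> \<in> space M. q (R \<omega>)} - \<eta> \<le> prob {\<omega> \<in> space M. R \<omega> \<le> r}"
    using K(3) by (simp add: D[OF B] preB)
  moreover have "{\<omega> \<in> space M. q (R \<omega>)} \<in> events"
    using measurable_sets[OF R B] by (simp add: preB)
  ultimately show thesis using r(1,2) that by blast
qed

lemma with_high_prob_random_radius:
  fixes T :: "nat \<Rightarrow> real \<Rightarrow> 'w \<Rightarrow> ennreal" and g :: "nat \<Rightarrow> real \<Rightarrow> ennreal" and R :: "nat \<Rightarrow> 'w \<Rightarrow> real"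
  assumes P: "\<And>n. prob_space (P n)"
    and R: "\<And>n. R n \<in> borel_measurable (P n)" "\<And>n \<omega>. 0 \<le> R n \<omega>"
    and mono: "\<And>n r s \<omega>. 0 \<le> r \<Longrightarrow> r \<le> s \<Longrightarrow> T n r \<omega> \<le> T n s \<omega>"
    and T: "\<forall>\<^sub>F n in sequentially. \<forall>r\<ge>0. T n r \<in> borel_measurable (P n) \<and>
      (\<integral>\<^sup>+\<omega>. T n r \<omega> \<partial>P n) = g n r"
    and a: "filterlim a at_top sequentially"
    and c: "((\<lambda>r. limsup (\<lambda>n. g n r)) \<longlongrightarrow> 0) (at_right 0)"
    and d: "converges_in_prob_0 P (\<lambda>n \<omega>. ennreal (a n * R n \<omega>) * g n (R n \<omega>))"
    and \<epsilon>: "\<epsilon> > 0"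
  shows "with_high_prob P (\<lambda>n \<omega>. T n (R n \<omega>) \<omega> \<le> ennreal \<epsilon> \<and>
    ennreal (a n * R n \<omega>) * T n (R n \<omega>) \<omega> \<le> ennreal \<epsilon>)"
  unfolding with_high_prob_def
proof (intro allI impI)
  fix \<eta> :: real assume \<eta>: "\<eta> > 0"
  \<comment> \<open>An expectation of at most \<open>e\<close> costs \<open>\<eta> / 4\<close> in
    Markov's inequality at level \<open>\<epsilon>\<close>. It is paid twice, for \<open>A1\<close>
    and \<open>A2\<close>. The other two quarters go to the event that \<open>q n\<close> fails at
    \<open>R n\<close> and to the mass lost in \<open>deterministic_radius\<close>.\<close>
  define e where "e = \<epsilon> * (\<eta> / 4)"
  have e: "e > 0" using \<epsilon> \<eta> by (simp add: e_def)
  have "\<forall>\<^sub>F r in at_right 0. limsup (\<lambda>n. g n r) < ennreal e"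
    using order_tendstoD(2)[OF c, of "ennreal e"] e by simp
  then have "\<exists>r>0. limsup (\<lambda>n. g n r) < ennreal e"
    unfolding eventually_at_right_field by (meson dense)
  then obtain r0 where r0: "r0 > 0" "limsup (\<lambda>n. g n r0) < ennreal e" by blast
  \<comment> \<open>Once \<open>a n\<close> is positive, both factors increase with
    \<open>r\<close>, so \<open>q n\<close> is closed downwards as
    \<open>deterministic_radius\<close> demands.\<close>
  define q where "q n r \<longleftrightarrow> ennreal (a n * r) * g n r \<le> ennreal e" for n r
  have "\<forall>\<^sub>F n in sequentially. g n r0 < ennreal e" using r0(2) by (rule Limsup_lessD)
  moreover have "\<forall>\<^sub>F n in sequentially. 1 / r0 \<le> a n" using a by (simp add: filterlim_at_top)
  moreover have "\<forall>\<^sub>F n in sequentially.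
      measure (P n) {\<omega> \<in> space (P n). ennreal (a n * R n \<omega>) * g n (R n \<omega>) > ennreal e} < \<eta> / 4"
    using d[unfolded converges_in_prob_0_def, rule_format, OF e] \<eta>
    by (elim order_tendstoD(2)) simp
  ultimately show "\<forall>\<^sub>F n in sequentially. \<exists>G\<in>sets (P n). 1 - \<eta> \<le> measure (P n) G \<and>
    (\<forall>\<omega>\<in>G. T n (R n \<omega>) \<omega> \<le> ennreal \<epsilon> \<and> ennreal (a n * R n \<omega>) * T n (R n \<omega>) \<omega> \<le> ennreal \<epsilon>)"
    using T
  proof eventually_elim
    case (elim n)
    interpret prob_space "P n" by (rule P)
    have Tg: "T n r \<in> borel_measurable (P n)" "(\<integral>\<^sup>+\<omega>. T n r \<omega> \<partial>P n) = g n r" if "0 \<le> r" for r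
      using elim(4) that by auto
    have g_mono: "g n r \<le> g n s" if "0 \<le> r" "r \<le> s" for r s
      using that mono by (auto simp: Tg(2)[symmetric] intro!: nn_integral_mono)
    have a0: "0 < a n" using elim(2) r0(1) by (smt (verit) divide_pos_pos)
    have "q n 0" by (simp add: q_def)
    moreover have qm: "q n r" if "0 \<le> r" "r \<le> s" "q n s" for r s
      using that(3) g_mono[OF that(1,2)] that(1,2) a0 unfolding q_def
      by (elim order_trans[rotated]) (intro mult_mono ennreal_leI; simp)
    moreover have "\<eta> / 4 > 0" using \<eta> by simp
    ultimately obtain r where r: "0 \<le> r" "q n r"
      "prob {\<omega> \<in> space (P n). q n (R n \<omega>)} - \<eta> / 4 \<le> prob {\<omega> \<in> space (P n). R n \<omega> \<le> r}"
      "{\<omega> \<in> space (P n). q n (R n \<omega>)} \<in> events"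
      using deterministic_radius[OF R(1)[of n] R(2), of "q n" "\<eta> / 4"] by blast
    have gr: "g n r \<le> ennreal e"
    proof (cases "r \<le> r0")
      case True
      then show ?thesis using g_mono[OF r(1) True] elim(1) by simp
    next
      case False
      have "1 \<le> a n * r" using mult_mono[OF elim(2), of r0 r] False r0(1) a0 by simp
      then have "1 * g n r \<le> ennreal (a n * r) * g n r" by (intro mult_right_mono) auto
      then show ?thesis using r(2) by (simp add: q_def)
    qed
    have Tr: "T n r \<in> borel_measurable (P n)" using Tg(1) r(1) .
    define A1 where "A1 = {\<omega> \<in> space (P n). T n r \<omega> \<le> ennreal \<epsilon>}"
    define A2 where "A2 = {\<omega> \<in> space (P n). ennreal (a n * r) * T n r \<omega> \<le> ennreal \<epsilon>}"
    define A3 where "A3 = {\<omega> \<in> space (P n). R n \<omega> \<le> r}"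
    note [measurable] = Tr R(1)[of n]
    have ev: "A1 \<in> events" "A2 \<in> events" "A3 \<in> events" unfolding A1_def A2_def A3_def by measurable
    have "1 - \<eta> / 4 \<le> prob A1"
      unfolding A1_def using gr \<epsilon> \<eta>
      by (intro prob_gt_le_of_nn_integral_le Tr) (auto simp: Tg(2)[OF r(1)] e_def)
    moreover have "1 - \<eta> / 4 \<le> prob A2"
      unfolding A2_def using r(2) \<epsilon> \<eta>
      by (intro prob_gt_le_of_nn_integral_le) (auto simp: Tg(2)[OF r(1)] e_def q_def nn_integral_cmult)
    ultimately have A12: "1 - (\<eta> / 4 + \<eta> / 4) \<le> prob (A1 \<inter> A2)" by (intro prob_Int_ge ev)
    have "prob (space (P n) - {\<omega> \<in> space (P n). q n (R n \<omega>)}) < \<eta> / 4"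
      using elim(3) by (simp add: q_def set_diff_eq not_le conj_commute cong: conj_cong)
    then have A3: "1 - (\<eta> / 4 + \<eta> / 4) \<le> prob A3"
      using r(3) by (simp add: prob_compl[OF r(4)] A3_def)
    have "1 - (\<eta> / 4 + \<eta> / 4 + (\<eta> / 4 + \<eta> / 4)) \<le> prob (A1 \<inter> A2 \<inter> A3)"
      by (rule prob_Int_ge[OF sets.Int[OF ev(1,2)] ev(3) A12 A3])
    moreover have "T n (R n \<omega>) \<omega> \<le> ennreal \<epsilon> \<and> ennreal (a n * R n \<omega>) * T n (R n \<omega>) \<omega> \<le> ennreal \<epsilon>"
      if "\<omega> \<in> A1 \<inter> A2 \<inter> A3" for \<omega>
    proof
      have *: "T n (R n \<omega>) \<omega> \<le> T n r \<omega>" "R n \<omega> \<le> r"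
        using that R(2) by (auto simp: A3_def intro!: mono)
      show "T n (R n \<omega>) \<omega> \<le> ennreal \<epsilon>" using * that by (auto simp: A1_def)
      have "ennreal (a n * R n \<omega>) * T n (R n \<omega>) \<omega> \<le> ennreal (a n * r) * T n r \<omega>"
        using * a0 R(2) by (intro mult_mono ennreal_leI) auto
      then show "ennreal (a n * R n \<omega>) * T n (R n \<omega>) \<omega> \<le> ennreal \<epsilon>" using that by (auto simp: A2_def)
    qed
    ultimately show ?case using ev by (intro bexI[of _ "A1 \<inter> A2 \<inter> A3"]) auto
  qed
qed

section \<open>Weak convergence: reflection, perturbation, symmetry of the normal law\<close>

lemma converges_in_distr_uminus:
  fixes Z :: "nat \<Rightarrow> 'w \<Rightarrow> 'b::{real_normed_vector, second_countable_topology}"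
  assumes Z: "converges_in_distr P Z \<nu>" and meas: "\<And>n. Z n \<in> borel_measurable (P n)"
    and sym: "\<And>f :: 'b \<Rightarrow> real. continuous_on UNIV f \<Longrightarrow> (\<integral>x. f (- x) \<partial>\<nu>) = (\<integral>x. f x \<partial>\<nu>)"
  shows "converges_in_distr P (\<lambda>n \<omega>. - Z n \<omega>) \<nu>"
  unfolding converges_in_distr_def weakly_converges_def
proof (intro allI impI, elim conjE)
  fix f :: "'b \<Rightarrow> real" assume f: "continuous_on UNIV f" "bounded (range f)"
  have cf: "continuous_on UNIV (\<lambda>x. f (- x))"
    by (intro continuous_on_compose2[OF f(1)] continuous_intros) auto
  have "bounded (range (\<lambda>x. f (- x)))"
    by (rule bounded_subset[OF f(2)]) auto
  with Z cf have "(\<lambda>n. \<integral>x. f (- x) \<partial>distr (P n) borel (Z n)) \<longlonglongrightarrow> (\<integral>x. f (- x) \<partial>\<nu>)"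
    unfolding converges_in_distr_def weakly_converges_def by blast
  moreover have "(\<integral>x. f (- x) \<partial>distr (P n) borel (Z n)) = (\<integral>x. f x \<partial>distr (P n) borel (\<lambda>\<omega>. - Z n \<omega>))" for n
    using meas[of n] f(1) cf
    by (subst (1 2) integral_distr) (auto intro: borel_measurable_continuous_onI borel_measurable_uminus)
  ultimately show "(\<lambda>n. \<integral>x. f x \<partial>distr (P n) borel (\<lambda>\<omega>. - Z n \<omega>)) \<longlonglongrightarrow> (\<integral>x. f x \<partial>\<nu>)"
    by (simp add: sym[OF f(1)])
qed

text \<open>The definition of weak convergence puts no condition on the limit. Testing with the
  constant 1 supplies finiteness, so the total mass of the normal density need not be
  computed.\<close>

lemma converges_in_distr_limit_finite:
  assumes P: "\<And>n. prob_space (P n)" and meas: "\<And>n. Z n \<in> borel_measurable (P n)"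
    and Z: "converges_in_distr P Z \<nu>"
  shows "finite_measure \<nu>"
proof -
  have "(\<lambda>n. \<integral>x. (1::real) \<partial>distr (P n) borel (Z n)) \<longlonglongrightarrow> (\<integral>x. 1 \<partial>\<nu>)"
    using Z unfolding converges_in_distr_def weakly_converges_def
    by (elim allE[of _ "\<lambda>_. 1"]) (simp add: image_constant_conv)
  moreover have "(\<integral>x. (1::real) \<partial>distr (P n) borel (Z n)) = 1" for n
    using prob_space.prob_space[OF prob_space.prob_space_distr[OF P meas[of n]]] by simp
  ultimately have "measure \<nu> (space \<nu>) = 1" by (simp add: LIMSEQ_const_iff)
  \<comment> \<open>\<open>measure\<close> is 0 on sets of infinite measure, so the value 1 rules
    that out.\<close>
  then have "emeasure \<nu> (space \<nu>) \<noteq> \<infinity>" by (auto simp: measure_def)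
  then show ?thesis by (rule finite_measureI)
qed

text \<open>A continuous stand-in for the indicator of a large norm, rising from 0 at
  \<open>r\<close> to 1 at \<open>r + 1\<close>, so that tails can be tested under weak
  convergence.\<close>

definition norm_tail :: "real \<Rightarrow> 'b::real_normed_vector \<Rightarrow> real" where
  "norm_tail r x = min 1 (max 0 (norm x - r))"

lemma norm_tail_bounds: "0 \<le> norm_tail r x" "norm_tail r x \<le> 1"
  by (auto simp: norm_tail_def)

lemma continuous_on_norm_tail: "continuous_on UNIV (norm_tail r)"
  unfolding norm_tail_def[abs_def] by (intro continuous_intros)

text \<open>At each point the tail function vanishes once \<open>r\<close> exceeds the norm;
  dominated convergence with the constant 1 does the rest.\<close>

lemma ex_norm_tail_less:
  fixes \<nu> :: "'b::real_normed_vector measure"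
  assumes \<nu>: "finite_measure \<nu>" "sets \<nu> = sets borel" and \<eta>: "\<eta> > 0"
  obtains r where "0 \<le> r" "(\<integral>x. norm_tail r x \<partial>\<nu>) < \<eta>"
proof -
  interpret finite_measure \<nu> by (rule \<nu>)
  have meas: "norm_tail r \<in> borel_measurable \<nu>" for r
    using borel_measurable_continuous_onI[OF continuous_on_norm_tail] \<nu>(2) measurable_cong_sets by blast
  have "(\<lambda>k. \<integral>x. norm_tail (real k) x \<partial>\<nu>) \<longlonglongrightarrow> (\<integral>x. 0 \<partial>\<nu>)"
  proof (rule integral_dominated_convergence[where w = "\<lambda>_. 1"])
    show "AE x in \<nu>. (\<lambda>k. norm_tail (real k) x) \<longlonglongrightarrow> 0"
    proof (rule AE_I2)
      fix x :: 'b
      obtain k0 where "norm x \<le> real k0" using real_arch_simple by blast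
      then have "\<forall>\<^sub>F k in sequentially. norm_tail (real k) x = 0"
        by (auto simp: norm_tail_def eventually_sequentially intro!: exI[of _ k0])
      then show "(\<lambda>k. norm_tail (real k) x) \<longlonglongrightarrow> 0" by (rule tendsto_eventually)
    qed
    show "AE x in \<nu>. norm (norm_tail (real k) x) \<le> 1" for k
      by (simp add: norm_tail_bounds)
  qed (simp_all add: meas)
  then have "\<forall>\<^sub>F k in sequentially. (\<integral>x. norm_tail (real k) x \<partial>\<nu>) < \<eta>"
    using \<eta> by (intro order_tendstoD(2)) auto
  then obtain k where "(\<integral>x. norm_tail (real k) x \<partial>\<nu>) < \<eta>" by (auto dest: eventually_happens)
  then show thesis using that[of "real k"] by simp
qed

text \<open>Tightness of \<open>Z n\<close> need not be established beforehand, because the limit law is tight.\<close>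

lemma converges_in_distr_perturb:
  fixes Z Y :: "nat \<Rightarrow> 'w \<Rightarrow> 'b::euclidean_space"
  assumes P: "\<And>n. prob_space (P n)" and Z: "\<And>n. Z n \<in> borel_measurable (P n)"
    and Y: "\<And>n. Y n \<in> borel_measurable (P n)"
    and lim: "converges_in_distr P Z \<nu>" and \<nu>: "sets \<nu> = sets borel"
    and close: "\<And>\<delta>. \<delta> > 0 \<Longrightarrow> with_high_prob P (\<lambda>n \<omega>. norm (Y n \<omega> - Z n \<omega>) \<le> \<delta> * (1 + norm (Z n \<omega>)))"
  shows "converges_in_distr P Y \<nu>"
  unfolding converges_in_distr_def weakly_converges_def
proof (intro allI impI, elim conjE)
  fix f :: "'b \<Rightarrow> real" assume f: "continuous_on UNIV f" "bounded (range f)"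
  obtain b where b: "b > 0" "\<And>x. norm (f x) \<le> b" using f(2) by (auto simp: bounded_pos)
  have int: "(\<integral>x. h x \<partial>distr (P n) borel V) = (\<integral>\<omega>. h (V \<omega>) \<partial>P n)"
    if "continuous_on UNIV h" "V \<in> borel_measurable (P n)"
    for h :: "'b \<Rightarrow> real" and V :: "'w \<Rightarrow> 'b" and n
    using that by (intro integral_distr borel_measurable_continuous_onI)
  have fZ: "(\<lambda>n. \<integral>\<omega>. f (Z n \<omega>) \<partial>P n) \<longlonglongrightarrow> (\<integral>x. f x \<partial>\<nu>)"
    using lim f int[OF f(1) Z] unfolding converges_in_distr_def weakly_converges_def by auto
  have "(\<lambda>n. (\<integral>\<omega>. f (Y n \<omega>) \<partial>P n) - (\<integral>\<omega>. f (Z n \<omega>) \<partial>P n)) \<longlonglongrightarrow> 0"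
  proof (rule tendstoI)
    fix e :: real assume e: "e > 0"
    \<comment> \<open>\<open>1 + 4 * b\<close> is the factor of \<open>\<eta>\<close> in the closing
      estimate \<open>\<eta> + 2 * b * (\<eta> + \<eta>)\<close>; the 2 in \<open>\<eta>\<close>
      makes the final inequality strict.\<close>
    define c where "c = 1 + 4 * b"
    define \<eta> where "\<eta> = e / (2 * c)"
    have "c > 0" using b(1) by (simp add: c_def)
    then have "\<eta> > 0" "\<eta> * c = e / 2" using e by (simp_all add: \<eta>_def)
    then have \<eta>: "\<eta> > 0" "\<eta> * (1 + 4 * b) < e" using e by (auto simp: c_def)
    obtain r where r: "0 \<le> r" "(\<integral>x. norm_tail r x \<partial>\<nu>) < \<eta>"
      using ex_norm_tail_less[OF converges_in_distr_limit_finite[OF P Z lim] \<nu> \<eta>(1)] .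
    have "bounded (range (norm_tail r :: 'b \<Rightarrow> real))"
      by (intro boundedI[of _ 1]) (auto simp: norm_tail_def)
    then have "(\<lambda>n. \<integral>\<omega>. norm_tail r (Z n \<omega>) \<partial>P n) \<longlonglongrightarrow> (\<integral>x. norm_tail r x \<partial>\<nu>)"
      using lim continuous_on_norm_tail[of r] int[OF continuous_on_norm_tail[of r] Z]
      unfolding converges_in_distr_def weakly_converges_def by auto
    then have tail: "\<forall>\<^sub>F n in sequentially. (\<integral>\<omega>. norm_tail r (Z n \<omega>) \<partial>P n) < \<eta>"
      using r(2) by (rule order_tendstoD(2))
    \<comment> \<open>Where \<open>Z n\<close> has norm below \<open>r + 1\<close>, the deviation of
      \<open>Y n\<close> is at most \<open>\<delta> * (r + 2)\<close>. The choice of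
      \<open>\<delta>\<close> keeps this at most 1, so both points lie in this ball, and below
      \<open>\<rho>\<close>, so uniform continuity applies.\<close>
    have "uniformly_continuous_on (cball 0 (r + 2)) f"
      by (rule compact_uniformly_continuous[OF continuous_on_subset[OF f(1)]]) auto
    then obtain \<rho> where \<rho>: "\<rho> > 0"
      "\<And>x y. x \<in> cball 0 (r + 2) \<Longrightarrow> y \<in> cball 0 (r + 2) \<Longrightarrow> dist y x < \<rho> \<Longrightarrow> dist (f y) (f x) < \<eta>"
      unfolding uniformly_continuous_on_def using \<eta>(1) by metis
    define \<delta> where "\<delta> = min 1 (\<rho> / 2) / (r + 2)"
    have \<delta>: "\<delta> > 0" "\<delta> * (r + 2) \<le> 1" "\<delta> * (r + 2) < \<rho>" using \<rho>(1) r(1) by (auto simp: \<delta>_def min_def)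
    show "\<forall>\<^sub>F n in sequentially. dist ((\<integral>\<omega>. f (Y n \<omega>) \<partial>P n) - (\<integral>\<omega>. f (Z n \<omega>) \<partial>P n)) 0 < e"
      using tail close[OF \<delta>(1), unfolded with_high_prob_def, rule_format, OF \<eta>(1)]
    proof eventually_elim
      case (elim n)
      interpret prob_space "P n" by (rule P)
      obtain G where G: "G \<in> events" "1 - \<eta> \<le> prob G"
        "\<And>\<omega>. \<omega> \<in> G \<Longrightarrow> norm (Y n \<omega> - Z n \<omega>) \<le> \<delta> * (1 + norm (Z n \<omega>))" using elim(2) by blast
      have iY: "integrable (P n) (\<lambda>\<omega>. f (Y n \<omega>))" and iZ: "integrable (P n) (\<lambda>\<omega>. f (Z n \<omega>))"
        using borel_measurable_continuous_on[OF f(1) Y[of n]] borel_measurable_continuous_on[OF f(1) Z[of n]] b(2)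
        by (auto intro!: integrable_const_bound[where B = b])
      have iT: "integrable (P n) (\<lambda>\<omega>. norm_tail r (Z n \<omega>))"
        using borel_measurable_continuous_on[OF continuous_on_norm_tail Z[of n], of r]
        by (auto intro!: integrable_const_bound[where B = 1] simp: norm_tail_bounds)
      define C where "C = space (P n) - G"
      have C: "C \<in> events" "prob C \<le> \<eta>" using G by (auto simp: C_def prob_compl)
      have iC: "integrable (P n) (indicator C :: 'w \<Rightarrow> real)" 
        using C(1) emeasure_finite[of C] by (intro integrable_real_indicator) (auto simp: less_top[symmetric])
      have pt: "norm (f (Y n \<omega>) - f (Z n \<omega>)) \<le> \<eta> + 2 * b * (norm_tail r (Z n \<omega>) + indicator C \<omega>)"
        if \<omega>: "\<omega> \<in> space (P n)" for \<omega>
      proof (cases "\<omega> \<in> G \<and> norm (Z n \<omega>) < r + 1")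
        case True
        have "norm (Y n \<omega> - Z n \<omega>) \<le> \<delta> * (1 + norm (Z n \<omega>))" using True G(3) by blast
        also have "\<dots> \<le> \<delta> * (r + 2)" using True \<delta>(1) by (intro mult_left_mono) auto
        finally have yz: "norm (Y n \<omega> - Z n \<omega>) \<le> \<delta> * (r + 2)" .
        then have "norm (Y n \<omega>) \<le> r + 2"
          using \<delta>(2) True norm_triangle_sub[of "Y n \<omega>" "Z n \<omega>"] by linarith
        then have "dist (f (Y n \<omega>)) (f (Z n \<omega>)) < \<eta>"
          using yz \<delta>(3) True by (intro \<rho>(2)) (auto simp: dist_norm)
        moreover have "0 \<le> 2 * b * (norm_tail r (Z n \<omega>) + indicator C \<omega>)"
          using b(1) norm_tail_bounds(1)[of r "Z n \<omega>"] by simp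
        ultimately show ?thesis unfolding dist_norm by linarith
      next
        case False
        \<comment> \<open>Either the point lies in \<open>C\<close>, or the norm of
          \<open>Z n\<close> is at least \<open>r + 1\<close>, where the tail function equals 1; the
          crude bound \<open>2 * b\<close> then suffices.\<close>
        then have "1 \<le> norm_tail r (Z n \<omega>) + indicator C \<omega>"
          using \<omega> norm_tail_bounds(1)[of r "Z n \<omega>"] by (auto simp: C_def norm_tail_def indicator_def)
        then have "2 * b * 1 \<le> 2 * b * (norm_tail r (Z n \<omega>) + indicator C \<omega>)"
          using b(1) by (intro mult_left_mono) auto
        moreover have "norm (f (Y n \<omega>) - f (Z n \<omega>)) \<le> 2 * b"
          using norm_triangle_ineq4[of "f (Y n \<omega>)" "f (Z n \<omega>)"] b(2)[of "Y n \<omega>"] b(2)[of "Z n \<omega>"] by linarith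
        ultimately show ?thesis using \<eta>(1) by linarith
      qed
      have "norm ((\<integral>\<omega>. f (Y n \<omega>) \<partial>P n) - (\<integral>\<omega>. f (Z n \<omega>) \<partial>P n)) = norm (\<integral>\<omega>. f (Y n \<omega>) - f (Z n \<omega>) \<partial>P n)"
        using iY iZ by simp
      also have "\<dots> \<le> (\<integral>\<omega>. \<eta> + 2 * b * (norm_tail r (Z n \<omega>) + indicator C \<omega>) \<partial>P n)"
        using iY iZ iT iC pt
        by (intro order_trans[OF integral_norm_bound] integral_mono integrable_norm Bochner_Integration.integrable_diff
            Bochner_Integration.integrable_add integrable_mult_right) auto
      also have "\<dots> = \<eta> + 2 * b * ((\<integral>\<omega>. norm_tail r (Z n \<omega>) \<partial>P n) + prob C)"
        using iT iC C(1) by (simp add: prob_space)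
      also have "\<dots> \<le> \<eta> + 2 * b * (\<eta> + \<eta>)"
        using elim(1) C(2) b(1) by (intro add_left_mono mult_left_mono add_mono) auto
      also have "\<dots> < e" using \<eta>(2) by (simp add: algebra_simps)
      finally show ?case by simp
    qed
  qed
  from tendsto_add[OF this fZ] have "(\<lambda>n. \<integral>\<omega>. f (Y n \<omega>) \<partial>P n) \<longlonglongrightarrow> (\<integral>x. f x \<partial>\<nu>)" by simp
  then show "(\<lambda>n. \<integral>x. f x \<partial>distr (P n) borel (Y n)) \<longlonglongrightarrow> (\<integral>x. f x \<partial>\<nu>)"
    by (simp add: int[OF f(1) Y])
qed

lemma lborel_distr_uminus_euclidean: "distr lborel borel uminus = (lborel :: 'b::euclidean_space measure)"
proof -
  from lborel_affine[of "-1" "0 :: 'b"] show ?thesis by (simp add: density_1)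
qed

text \<open>The density is even and Lebesgue measure is invariant under reflection.\<close>

lemma std_normal_vec_symmetric:
  fixes f :: "real^'m \<Rightarrow> real"
  assumes f: "continuous_on UNIV f"
  shows "(\<integral>x. f (- x) \<partial>std_normal_vec) = (\<integral>x. f x \<partial>std_normal_vec)"
proof -
  define \<phi> :: "real^'m \<Rightarrow> real" where "\<phi> x = (\<Prod>j\<in>UNIV. std_normal_density (x $ j))" for x
  have \<phi>: "\<phi> \<in> borel_measurable borel"
    unfolding \<phi>_def[abs_def]
    by (rule borel_measurable_prod) (rule measurable_compose[OF borel_measurable_nth borel_measurable_normal_density])
  have \<phi>0: "0 \<le> \<phi> x" for x unfolding \<phi>_def by (intro prod_nonneg) simp
  have fm: "f \<in> borel_measurable borel" "(\<lambda>x. f (- x)) \<in> borel_measurable borel"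
    using borel_measurable_continuous_onI[OF f] by (auto intro: measurable_compose[OF borel_measurable_uminus])
  have even: "\<phi> (- x) = \<phi> x" for x by (simp add: \<phi>_def std_normal_density_def)
  have dens: "(\<integral>x. h x \<partial>std_normal_vec) = (\<integral>x. \<phi> x * h x \<partial>lborel)"
    if "h \<in> borel_measurable borel" for h :: "real^'m \<Rightarrow> real"
    unfolding std_normal_vec_def \<phi>_def[symmetric]
    using that \<phi> \<phi>0 by (subst integral_density) auto
  have "(\<integral>x. \<phi> x * f x \<partial>lborel) = (\<integral>x. \<phi> x * f x \<partial>distr lborel borel uminus)"
    by (simp only: lborel_distr_uminus_euclidean)
  also have "\<dots> = (\<integral>x. \<phi> (- x) * f (- x) \<partial>lborel)"
    by (rule integral_distr) (auto intro!: borel_measurable_times \<phi> fm)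
  finally show ?thesis by (simp add: dens fm even)
qed

section \<open>The one-step estimator: error on a good event, measurability\<close>

text \<open>The value \<infinity> off \<open>\<Theta>\<close> preserves monotonicity when the
  growing ball leaves \<open>\<Theta>\<close>.\<close>

lemma tau_mono:
  assumes "0 \<le> r" "r \<le> s"
  shows "tau P X M' \<Theta> \<theta> n i r x \<le> tau P X M' \<Theta> \<theta> n i s x"
proof (cases "cball \<theta> s \<subseteq> \<Theta>")
  case True
  have "cball \<theta> r \<subseteq> cball \<theta> s" using assms by (simp add: subset_cball)
  then show ?thesis using True unfolding tau_def by (auto intro!: SUP_subset_mono)
qed (simp add: tau_def)

lemma borel_measurable_matrix_vector_mult:
  fixes A :: "real^'n^'m"
  assumes "f \<in> borel_measurable N"
  shows "(\<lambda>x. A *v f x) \<in> borel_measurable N"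
  by (rule borel_measurable_continuous_on[OF _ assms])
    (rule linear_continuous_on[OF matrix_vector_mul_bounded_linear])

text \<open>Translates bounds in [0, \<infinity>] at one sample point into the real hypotheses of
  \<open>one_step_error\<close>, with \<open>enn2real\<close> of the \<open>tau\<close> values as
  oscillation bounds.\<close>

lemma one_step_close:
  fixes P :: "nat \<Rightarrow> 'w measure" and X :: "nat \<Rightarrow> nat \<Rightarrow> 'w \<Rightarrow> 'x" and \<theta> :: "real^'m" and n :: nat
    and M :: "nat \<Rightarrow> nat \<Rightarrow> real^'m \<Rightarrow> 'x \<Rightarrow> real^'m"
    and M' :: "nat \<Rightarrow> nat \<Rightarrow> real^'m \<Rightarrow> 'x \<Rightarrow> real^'m^'m"
  defines "J \<equiv> J_mat P X M' \<theta> n" and "A \<equiv> mat_inv_sqrt (I_mat P X M \<theta> n)"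
    and "L \<equiv> mat_sqrt (I_mat P X M \<theta> n)"
  assumes n: "1 \<le> n" and J: "invertible J" and I: "pos_def_mat (I_mat P X M \<theta> n)"
    and C: "norm L * norm A \<le> C" and \<epsilon>: "0 \<le> \<epsilon>" "\<epsilon> \<le> 1/4"
    and incr: "\<And>i t1 t2. i \<in> {1..n} \<Longrightarrow> closed_segment t1 t2 \<subseteq> \<Theta> \<Longrightarrow>
          (\<lambda>v. M' n i (t1 + v *\<^sub>R (t2 - t1)) (X n i \<omega>)) integrable_on {0..1} \<and>
          M n i t2 (X n i \<omega>) - M n i t1 (X n i \<omega>) =
            integral {0..1} (\<lambda>v. M' n i (t1 + v *\<^sub>R (t2 - t1)) (X n i \<omega>)) *v (t2 - t1)"
    and lln: "norm ((\<Sum>i=1..n. M' n i \<theta> (X n i \<omega>)) ** matrix_inv J - mat 1) \<le> \<epsilon>"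
    and T: "(\<Sum>i=1..n. tau P X M' \<Theta> \<theta> n i (norm (est_value X est n \<omega> - \<theta>)) (X n i \<omega>)) \<le> ennreal \<epsilon>"
    and aT: "ennreal (norm A * norm J * norm (est_value X est n \<omega> - \<theta>)) *
      (\<Sum>i=1..n. tau P X M' \<Theta> \<theta> n i (norm (est_value X est n \<omega> - \<theta>)) (X n i \<omega>)) \<le> ennreal \<epsilon>"
  shows "one_step_defined X M' \<Theta> est n \<omega>"
    and "norm (A *v (J *v (one_step X M M' \<Theta> est d n \<omega> - \<theta>)) + A *v (\<Sum>i=1..n. M n i \<theta> (X n i \<omega>)))
      \<le> 4 * norm (mat 1 :: real^'m^'m) * \<epsilon> * (C * norm (A *v (\<Sum>i=1..n. M n i \<theta> (X n i \<omega>))) + 1)"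
proof -
  define t where "t = est_value X est n \<omega>"
  define \<tau> where "\<tau> i = tau P X M' \<Theta> \<theta> n i (norm (t - \<theta>)) (X n i \<omega>)" for i
  define T' where "T' = (\<Sum>i\<in>{1..n}. enn2real (\<tau> i))"
  have sum: "(\<Sum>i=1..n. \<tau> i) \<le> ennreal \<epsilon>" using T by (simp add: \<tau>_def t_def)
  have fin: "\<tau> i < top" if "i \<in> {1..n}" for i
    using order_trans[OF member_le_sum[of i "{1..n}" \<tau>, OF that] sum]
    by (auto intro: le_less_trans[OF _ ennreal_less_top])
  \<comment> \<open>A finite \<open>tau\<close> value means that its ball lies in
    \<open>\<Theta>\<close>. At least one summand is required: for \<open>n = 0\<close> the sum is
    empty and does not confine the estimate.\<close>
  from fin[of 1] n have ball: "cball \<theta> (norm (t - \<theta>)) \<subseteq> \<Theta>"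
    by (auto simp: \<tau>_def tau_def split: if_splits)
  have seg: "closed_segment \<theta> t \<subseteq> \<Theta>"
    using ball by (rule order_trans[rotated])
      (intro closed_segment_subset; simp add: dist_norm norm_minus_commute)
  then have tT: "t \<in> \<Theta>" by auto
  have T'_eq: "T' = enn2real (\<Sum>i=1..n. \<tau> i)"
    unfolding T'_def using fin by (subst enn2real_sum) auto
  then have T'\<epsilon>: "T' \<le> \<epsilon>" using sum \<epsilon> by (simp add: enn2real_leI)
  have T'0: "0 \<le> T'" by (simp add: T'_eq)
  have "(\<Sum>i=1..n. \<tau> i) < top" using sum ennreal_less_top by (rule le_less_trans)
  then have "(\<Sum>i=1..n. \<tau> i) = ennreal T'" by (simp add: T'_eq)
  with aT have "ennreal (norm A * norm J * norm (t - \<theta>)) * ennreal T' \<le> ennreal \<epsilon>"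
    by (simp add: \<tau>_def t_def)
  then have aT': "norm A * norm J * norm (t - \<theta>) * T' \<le> \<epsilon>"
    using \<epsilon> T'0 by (simp add: ennreal_mult'[symmetric] ennreal_le_iff)
  have osc: "norm ((M' n i u (X n i \<omega>) - M' n i \<theta> (X n i \<omega>)) ** matrix_inv J) \<le> enn2real (\<tau> i)"
    if i: "i \<in> {1..n}" and u: "u \<in> cball \<theta> (norm (t - \<theta>))" for i u
  proof -
    have "ennreal (norm ((M' n i u (X n i \<omega>) - M' n i \<theta> (X n i \<omega>)) ** matrix_inv J)) \<le> \<tau> i"
      using ball u unfolding \<tau>_def tau_def J_def by (auto intro!: SUP_upper)
    from enn2real_mono[OF this fin[OF i]] show ?thesis by simp
  qed
  have LA: "L ** A = mat 1" unfolding L_def A_def by (rule mat_sqrt_mult_mat_inv_sqrt[OF I])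
  \<comment> \<open>One \<open>\<epsilon>\<close> from the law of large numbers and one from the
    oscillation; \<open>\<epsilon> \<le> 1/4\<close> was chosen to make this at most 1/2.\<close>
  have \<delta>: "norm ((\<Sum>i=1..n. M' n i \<theta> (X n i \<omega>)) ** matrix_inv J - mat 1) + T' \<le> 2 * \<epsilon>"
    "2 * \<epsilon> \<le> 1/2" using lln T'\<epsilon> \<epsilon> by auto
  note err = one_step_error[OF LA J incr[OF _ seg] osc \<delta>(1)[unfolded T'_def] \<delta>(2), folded T'_def]
  show def: "one_step_defined X M' \<Theta> est n \<omega>"
    using tT err(1) unfolding one_step_defined_def t_def by blast
  define s where "s = A *v (\<Sum>i=1..n. M n i \<theta> (X n i \<omega>))"
  have "norm (A *v (J *v (one_step X M M' \<Theta> est d n \<omega> - \<theta>)) + s)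
    \<le> 2 * norm (mat 1 :: real^'m^'m) * (2 * \<epsilon> * (norm L * norm A) * norm s
      + norm A * norm J * norm (t - \<theta>) * (2 * T'))"
    using err(2) def by (simp add: one_step_def t_def s_def)
  also have "\<dots> \<le> 2 * norm (mat 1 :: real^'m^'m) * (2 * \<epsilon> * C * norm s + 2 * \<epsilon>)"
    using C \<epsilon> aT' by (intro mult_left_mono add_mono mult_right_mono) auto
  finally show "norm (A *v (J *v (one_step X M M' \<Theta> est d n \<omega> - \<theta>)) + A *v (\<Sum>i=1..n. M n i \<theta> (X n i \<omega>)))
      \<le> 4 * norm (mat 1 :: real^'m^'m) * \<epsilon> * (C * norm (A *v (\<Sum>i=1..n. M n i \<theta> (X n i \<omega>))) + 1)"
    by (simp add: s_def algebra_simps)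
qed

text \<open>The score and derivative sums are measurable only where the estimate lies in
  \<open>\<Theta>\<close>, so they are set to zero elsewhere. As the zero matrix is singular, the
  one-step estimator is defined exactly where the truncated matrix \<open>B\<close> is
  invertible.\<close>

lemma
  fixes M :: "nat \<Rightarrow> nat \<Rightarrow> real^'m \<Rightarrow> 'x \<Rightarrow> real^'m"
    and M' :: "nat \<Rightarrow> nat \<Rightarrow> real^'m \<Rightarrow> 'x \<Rightarrow> real^'m^'m"
  assumes est: "est_value X est n \<in> borel_measurable (P n)" and \<Theta>: "open \<Theta>"
    and M: "\<And>i. i \<in> {1..n} \<Longrightarrow> (\<lambda>\<omega>. M n i (est_value X est n \<omega>) (X n i \<omega>)) \<in> borel_measurable
          (restrict_space (P n) {\<omega> \<in> space (P n). est_value X est n \<omega> \<in> \<Theta>})"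
    and M': "\<And>i. i \<in> {1..n} \<Longrightarrow> (\<lambda>\<omega>. M' n i (est_value X est n \<omega>) (X n i \<omega>)) \<in> borel_measurable
          (restrict_space (P n) {\<omega> \<in> space (P n). est_value X est n \<omega> \<in> \<Theta>})"
  shows sets_one_step_defined: "{\<omega> \<in> space (P n). one_step_defined X M' \<Theta> est n \<omega>} \<in> sets (P n)"
    and borel_measurable_one_step:
      "d n \<in> borel_measurable (P n) \<Longrightarrow> one_step X M M' \<Theta> est d n \<in> borel_measurable (P n)"
proof -
  define E where "E = {\<omega> \<in> space (P n). est_value X est n \<omega> \<in> \<Theta>}"
  have E: "E \<in> sets (P n)"
    using measurable_sets[OF est, of \<Theta>] \<Theta> by (simp add: E_def vimage_def Int_def conj_commute)
  define B where "B \<omega> = indicator E \<omega> *\<^sub>R (\<Sum>i=1..n. M' n i (est_value X est n \<omega>) (X n i \<omega>))" for \<omega>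
  define b where "b \<omega> = indicator E \<omega> *\<^sub>R (\<Sum>i=1..n. M n i (est_value X est n \<omega>) (X n i \<omega>))" for \<omega>
  have EI: "E \<inter> space (P n) \<in> sets (P n)" using E by auto
  have B: "B \<in> borel_measurable (P n)"
    unfolding B_def[abs_def]
    by (rule iffD1[OF borel_measurable_restrict_space_iff[OF EI]], unfold E_def)
      (intro borel_measurable_sum M')
  have b: "b \<in> borel_measurable (P n)"
    unfolding b_def[abs_def]
    by (rule iffD1[OF borel_measurable_restrict_space_iff[OF EI]], unfold E_def)
      (intro borel_measurable_sum M)
  have not_inv_0: "\<not> invertible (0 :: real^'m^'m)"
    by (auto simp: invertible_def matrix_matrix_mult_def mat_def vec_eq_iff)
  have def_iff: "one_step_defined X M' \<Theta> est n \<omega> \<longleftrightarrow> invertible (B \<omega>)" if "\<omega> \<in> space (P n)" for \<omega>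
    using that not_inv_0 by (simp add: one_step_defined_def B_def E_def indicator_def)
  have det: "(\<lambda>\<omega>. det (B \<omega>)) \<in> borel_measurable (P n)"
    by (intro borel_measurable_det borel_measurable_mat_entry B)
  have "{\<omega> \<in> space (P n). one_step_defined X M' \<Theta> est n \<omega>} = {\<omega> \<in> space (P n). det (B \<omega>) \<noteq> 0}"
    by (auto simp: def_iff invertible_det_nz)
  also have "\<dots> \<in> sets (P n)"
    using measurable_sets[OF det, of "- {0}"] by (simp add: vimage_def Int_def conj_commute)
  finally show "{\<omega> \<in> space (P n). one_step_defined X M' \<Theta> est n \<omega>} \<in> sets (P n)" .
  assume d: "d n \<in> borel_measurable (P n)"
  \<comment> \<open>The fallback value is chosen so that subtracting it from the estimate leaves
    \<open>d n \<omega>\<close>; this brings the estimator into the form of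
    \<open>borel_measurable_matrix_inv_mult\<close>.\<close>
  have "one_step X M M' \<Theta> est d n \<omega> = est_value X est n \<omega> -
      (if invertible (B \<omega>) then matrix_inv (B \<omega>) *v b \<omega> else est_value X est n \<omega> - d n \<omega>)"
    if "\<omega> \<in> space (P n)" for \<omega>
    using def_iff[OF that] that not_inv_0
    by (auto simp: one_step_def B_def b_def E_def one_step_defined_def indicator_def)
  moreover have "(\<lambda>\<omega>. est_value X est n \<omega> -
      (if invertible (B \<omega>) then matrix_inv (B \<omega>) *v b \<omega> else est_value X est n \<omega> - d n \<omega>)) \<in> borel_measurable (P n)"
    by (intro borel_measurable_diff est borel_measurable_matrix_inv_mult B b d)
  ultimately show "one_step X M M' \<Theta> est d n \<in> borel_measurable (P n)"
    by (subst measurable_cong) auto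
qed

section \<open>Definedness and asymptotic normality of the one-step estimator\<close>

theorem mainTheorem9:
  fixes P :: "nat \<Rightarrow> 'w measure"
    and S :: "nat \<Rightarrow> 'x measure"
    and X :: "nat \<Rightarrow> nat \<Rightarrow> 'w \<Rightarrow> 'x"
    and \<Theta> :: "(real^'m) set"
    and \<theta> :: "real^'m"
    and M :: "nat \<Rightarrow> nat \<Rightarrow> real^'m \<Rightarrow> 'x \<Rightarrow> real^'m"
    and M' :: "nat \<Rightarrow> nat \<Rightarrow> real^'m \<Rightarrow> 'x \<Rightarrow> real^'m^'m"
    and est :: "nat \<Rightarrow> (nat \<Rightarrow> 'x) \<Rightarrow> real^'m"
    and d :: "nat \<Rightarrow> 'w \<Rightarrow> real^'m"
  assumes prob: "\<And>n. prob_space (P n)"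
    and indep: "\<And>n. prob_space.indep_vars (P n) (\<lambda>_. S n) (X n) {1..n}"
    and open_Theta: "open \<Theta>"
    and theta: "\<theta> \<in> \<Theta>"
    \<comment> \<open>measurability of the objects that are treated as random elements\<close>
    and meas_M: "\<And>n i t. i \<in> {1..n} \<Longrightarrow> t \<in> \<Theta> \<Longrightarrow> M n i t \<in> borel_measurable (S n)"
    and meas_M': "\<And>n i t. i \<in> {1..n} \<Longrightarrow> t \<in> \<Theta> \<Longrightarrow> M' n i t \<in> borel_measurable (S n)"
    and meas_tau: "\<And>n i r. i \<in> {1..n} \<Longrightarrow> 0 \<le> r \<Longrightarrow> invertible (J_mat P X M' \<theta> n) \<Longrightarrow>
        (\<lambda>\<omega>. tau P X M' \<Theta> \<theta> n i r (X n i \<omega>)) \<in> borel_measurable (P n)"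
    and meas_est: "\<And>n. est n \<in> borel_measurable (Pi\<^sub>M {1..n} (\<lambda>_. S n))"
    and meas_M_est: "\<And>n i. i \<in> {1..n} \<Longrightarrow>
        (\<lambda>\<omega>. M n i (est_value X est n \<omega>) (X n i \<omega>)) \<in> borel_measurable
          (restrict_space (P n) {\<omega> \<in> space (P n). est_value X est n \<omega> \<in> \<Theta>})"
    and meas_M'_est: "\<And>n i. i \<in> {1..n} \<Longrightarrow>
        (\<lambda>\<omega>. M' n i (est_value X est n \<omega>) (X n i \<omega>)) \<in> borel_measurable
          (restrict_space (P n) {\<omega> \<in> space (P n). est_value X est n \<omega> \<in> \<Theta>})"
    and meas_d: "\<And>n. d n \<in> borel_measurable (P n)"
    \<comment> \<open>(a)\<close>
    and a_increment: "\<And>n i. i \<in> {1..n} \<Longrightarrow>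
        AE \<omega> in P n. \<forall>t1 t2. closed_segment t1 t2 \<subseteq> \<Theta> \<longrightarrow>
          (\<lambda>v. M' n i (t1 + v *\<^sub>R (t2 - t1)) (X n i \<omega>)) integrable_on {0..1} \<and>
          M n i t2 (X n i \<omega>) - M n i t1 (X n i \<omega>) =
            integral {0..1} (\<lambda>v. M' n i (t1 + v *\<^sub>R (t2 - t1)) (X n i \<omega>)) *v (t2 - t1)"
    and a_M'_integrable: "\<And>n i j k. i \<in> {1..n} \<Longrightarrow>
        integrable (P n) (\<lambda>\<omega>. M' n i \<theta> (X n i \<omega>) $ j $ k)"
    and a_M_centred: "\<And>n i. i \<in> {1..n} \<Longrightarrow> (\<integral>\<omega>. M n i \<theta> (X n i \<omega>) \<partial>P n) = 0"
    and a_M_square: "\<And>n i. i \<in> {1..n} \<Longrightarrow>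
        integrable (P n) (\<lambda>\<omega>. (norm (M n i \<theta> (X n i \<omega>)))\<^sup>2)"
    \<comment> \<open>(b)\<close>
    and b_J: "\<forall>\<^sub>F n in sequentially. invertible (J_mat P X M' \<theta> n)"
    and b_I: "\<forall>\<^sub>F n in sequentially. pos_def_mat (I_mat P X M \<theta> n)"
    and b_rate: "filterlim (\<lambda>n. norm (mat_inv_sqrt (I_mat P X M \<theta> n)) * norm (J_mat P X M' \<theta> n))
        at_top sequentially"
    and b_cond: "bdd_above (range (\<lambda>n.
        norm (mat_sqrt (I_mat P X M \<theta> n)) * norm (mat_inv_sqrt (I_mat P X M \<theta> n))))"
    and b_lln: "converges_in_prob P
        (\<lambda>n \<omega>. (\<Sum>i=1..n. M' n i \<theta> (X n i \<omega>)) ** matrix_inv (J_mat P X M' \<theta> n)) (mat 1)"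
    and b_clt: "converges_in_distr P
        (\<lambda>n \<omega>. mat_inv_sqrt (I_mat P X M \<theta> n) *v (\<Sum>i=1..n. M n i \<theta> (X n i \<omega>))) std_normal_vec"
    \<comment> \<open>(c)\<close>
    and c: "((\<lambda>r. limsup (\<lambda>n. tau_bar P X M' \<Theta> \<theta> n r)) \<longlongrightarrow> 0) (at_right 0)"
    \<comment> \<open>(d)\<close>
    and d: "converges_in_prob_0 P (\<lambda>n \<omega>.
        ennreal (norm (mat_inv_sqrt (I_mat P X M \<theta> n)) * norm (J_mat P X M' \<theta> n)
                 * norm (est_value X est n \<omega> - \<theta>))
        * tau_bar P X M' \<Theta> \<theta> n (norm (est_value X est n \<omega> - \<theta>)))"
  shows "(\<lambda>n. measure (P n) {\<omega> \<in> space (P n). one_step_defined X M' \<Theta> est n \<omega>}) \<longlonglongrightarrow> 1 \<and>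
    converges_in_distr P
      (\<lambda>n \<omega>. mat_inv_sqrt (I_mat P X M \<theta> n) *v
               (J_mat P X M' \<theta> n *v (one_step X M M' \<Theta> est d n \<omega> - \<theta>)))
      std_normal_vec"
proof -
  define A where "A n = mat_inv_sqrt (I_mat P X M \<theta> n)" for n
  define L where "L n = mat_sqrt (I_mat P X M \<theta> n)" for n
  define J where "J n = J_mat P X M' \<theta> n" for n
  define R where "R n \<omega> = norm (est_value X est n \<omega> - \<theta>)" for n \<omega>
  define T where "T n r \<omega> = (\<Sum>i=1..n. tau P X M' \<Theta> \<theta> n i r (X n i \<omega>))" for n r \<omega>
  define s where "s n \<omega> = (\<Sum>i=1..n. M n i \<theta> (X n i \<omega>))" for n \<omega>
  define W where "W n \<omega> = (\<Sum>i=1..n. M' n i \<theta> (X n i \<omega>)) ** matrix_inv (J n)" for n \<omega>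
  define Y where "Y n \<omega> = A n *v (J n *v (one_step X M M' \<Theta> est d n \<omega> - \<theta>))" for n \<omega>
  define k where "k = norm (mat 1 :: real^'m^'m)"
  obtain C0 where C0: "norm (L n) * norm (A n) \<le> C0" for n
    using b_cond by (auto simp: bdd_above_def L_def A_def)
  define C where "C = max 0 C0"
  have C: "0 \<le> C" "norm (L n) * norm (A n) \<le> C" for n using C0[of n] by (auto simp: C_def)
  have X: "X n i \<in> measurable (P n) (S n)" if "i \<in> {1..n}" for n i
    using indep[of n] that by (simp add: prob_space.indep_vars_def[OF prob])
  have est: "est_value X est n \<in> borel_measurable (P n)" for n
    unfolding est_value_def[abs_def]
    by (rule measurable_compose[OF measurable_restrict meas_est]) (rule X)
  have R: "R n \<in> borel_measurable (P n)" for n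
    unfolding R_def[abs_def]
    by (intro measurable_compose[OF _ borel_measurable_norm] borel_measurable_diff est borel_measurable_const)
  have s: "s n \<in> borel_measurable (P n)" for n
    unfolding s_def[abs_def]
    by (rule borel_measurable_sum) (rule measurable_compose[OF X meas_M]; simp add: theta)
  have W: "W n \<in> borel_measurable (P n)" for n
    unfolding W_def[abs_def]
  proof (rule borel_measurable_continuous_on[where f = "\<lambda>B. B ** matrix_inv (J n)"])
    show "continuous_on UNIV (\<lambda>B. B ** matrix_inv (J n))"
      by (rule linear_continuous_on[OF bounded_linear_matrix_mult_right])
    show "(\<lambda>\<omega>. \<Sum>i=1..n. M' n i \<theta> (X n i \<omega>)) \<in> borel_measurable (P n)"
      by (rule borel_measurable_sum) (rule measurable_compose[OF X meas_M']; simp add: theta)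
  qed
  have Z: "(\<lambda>\<omega>. A n *v s n \<omega>) \<in> borel_measurable (P n)" for n
    by (rule borel_measurable_matrix_vector_mult[OF s])
  have Y: "Y n \<in> borel_measurable (P n)" for n
    unfolding Y_def[abs_def]
    by (intro borel_measurable_matrix_vector_mult borel_measurable_diff borel_measurable_const
        borel_measurable_one_step est open_Theta meas_M_est meas_M'_est meas_d)
  have T: "\<forall>\<^sub>F n in sequentially. \<forall>r\<ge>0. T n r \<in> borel_measurable (P n) \<and>
      (\<integral>\<^sup>+\<omega>. T n r \<omega> \<partial>P n) = tau_bar P X M' \<Theta> \<theta> n r"
    using b_J
  proof eventually_elim
    case (elim n)
    then show ?case
      unfolding T_def[abs_def] tau_bar_def
      by (intro allI impI conjI borel_measurable_sum nn_integral_sum meas_tau)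
  qed
  have radius: "with_high_prob P (\<lambda>n \<omega>. T n (R n \<omega>) \<omega> \<le> ennreal \<epsilon> \<and>
      ennreal (norm (A n) * norm (J n) * R n \<omega>) * T n (R n \<omega>) \<omega> \<le> ennreal \<epsilon>)" if "\<epsilon> > 0" for \<epsilon>
  proof (rule with_high_prob_random_radius[OF prob R _ _ T _ c _ that])
    show "T n r \<omega> \<le> T n r' \<omega>" if "0 \<le> r" "r \<le> r'" for n r r' \<omega>
      unfolding T_def using that by (intro sum_mono tau_mono)
    show "converges_in_prob_0 P (\<lambda>n \<omega>. ennreal (norm (A n) * norm (J n) * R n \<omega>) * tau_bar P X M' \<Theta> \<theta> n (R n \<omega>))"
      using d by (simp add: A_def J_def R_def)
  qed (use b_rate in \<open>simp_all add: A_def J_def R_def\<close>)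
  \<comment> \<open>In (a) the exceptional null set depends on \<open>i\<close> but not on the
    segment, so a finite union over \<open>i\<close> handles all segments at once, including the
    random one.\<close>
  have incr: "with_high_prob P (\<lambda>n \<omega>. \<forall>i\<in>{1..n}. \<forall>t1 t2. closed_segment t1 t2 \<subseteq> \<Theta> \<longrightarrow>
          (\<lambda>v. M' n i (t1 + v *\<^sub>R (t2 - t1)) (X n i \<omega>)) integrable_on {0..1} \<and>
          M n i t2 (X n i \<omega>) - M n i t1 (X n i \<omega>) =
            integral {0..1} (\<lambda>v. M' n i (t1 + v *\<^sub>R (t2 - t1)) (X n i \<omega>)) *v (t2 - t1))"
    by (rule with_high_prob_AE[OF prob], rule AE_finite_allI) (simp, rule a_increment)
  \<comment> \<open>The comparison variable is \<open>- (A n *v s n \<omega>)\<close>, the leading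
    term of the error. Definedness is recorded on the same event, and both conclusions are read off
    from it.\<close>
  have close: "with_high_prob P (\<lambda>n \<omega>. one_step_defined X M' \<Theta> est n \<omega> \<and>
      norm (Y n \<omega> - - (A n *v s n \<omega>)) \<le> \<delta> * (1 + norm (- (A n *v s n \<omega>))))" if \<delta>: "\<delta> > 0" for \<delta>
  proof -
    \<comment> \<open>The error 4 k \<epsilon> (C x + 1) of \<open>one_step_close\<close>, with x
      the norm of \<open>A n *v s n \<omega>\<close>, is at most 4 k (C + 1) \<epsilon> (1 + x).
      Using \<open>k + 1\<close> makes \<open>c\<close> visibly positive, so that division by it in
      \<open>\<epsilon>\<close> is safe.\<close>
    define c where "c = 4 * (k + 1) * (C + 1)"
    have "k \<ge> 0" by (simp add: k_def)
    then have c: "c > 0" "4 * k * (C + 1) \<le> c" using C(1) by (auto simp: c_def intro!: mult_right_mono)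
    define \<epsilon> where "\<epsilon> = min (1/4) (\<delta> / c)"
    have \<epsilon>: "\<epsilon> > 0" "\<epsilon> \<le> 1/4" "c * \<epsilon> \<le> \<delta>"
      using \<delta> c(1) by (auto simp: \<epsilon>_def min_def field_simps)
    have lln: "with_high_prob P (\<lambda>n \<omega>. dist (W n \<omega>) (mat 1) \<le> \<epsilon>)"
      using b_lln by (intro with_high_prob_of_converges_in_prob[OF prob _ W \<epsilon>(1)]) (simp add: W_def[abs_def] J_def)
    show ?thesis
    proof (rule with_high_prob_mono[OF with_high_prob_conj[OF prob incr with_high_prob_conj[OF prob lln radius[OF \<epsilon>(1)]]]])
      show "\<forall>\<^sub>F n in sequentially. \<forall>\<omega>\<in>space (P n).
         (\<forall>i\<in>{1..n}. \<forall>t1 t2. closed_segment t1 t2 \<subseteq> \<Theta> \<longrightarrow>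
          (\<lambda>v. M' n i (t1 + v *\<^sub>R (t2 - t1)) (X n i \<omega>)) integrable_on {0..1} \<and>
          M n i t2 (X n i \<omega>) - M n i t1 (X n i \<omega>) =
            integral {0..1} (\<lambda>v. M' n i (t1 + v *\<^sub>R (t2 - t1)) (X n i \<omega>)) *v (t2 - t1)) \<and>
         dist (W n \<omega>) (mat 1) \<le> \<epsilon> \<and> T n (R n \<omega>) \<omega> \<le> ennreal \<epsilon> \<and>
           ennreal (norm (A n) * norm (J n) * R n \<omega>) * T n (R n \<omega>) \<omega> \<le> ennreal \<epsilon> \<longrightarrow>
         one_step_defined X M' \<Theta> est n \<omega> \<and>
           norm (Y n \<omega> - - (A n *v s n \<omega>)) \<le> \<delta> * (1 + norm (- (A n *v s n \<omega>)))"
        using eventually_ge_at_top[of 1] b_J b_I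
      proof (eventually_elim, intro ballI impI, elim conjE)
        fix n \<omega>
        assume n: "1 \<le> n" and Jn: "invertible (J_mat P X M' \<theta> n)" and In: "pos_def_mat (I_mat P X M \<theta> n)"
          and i: "\<forall>i\<in>{1..n}. \<forall>t1 t2. closed_segment t1 t2 \<subseteq> \<Theta> \<longrightarrow>
          (\<lambda>v. M' n i (t1 + v *\<^sub>R (t2 - t1)) (X n i \<omega>)) integrable_on {0..1} \<and>
          M n i t2 (X n i \<omega>) - M n i t1 (X n i \<omega>) =
            integral {0..1} (\<lambda>v. M' n i (t1 + v *\<^sub>R (t2 - t1)) (X n i \<omega>)) *v (t2 - t1)"
          and w: "dist (W n \<omega>) (mat 1) \<le> \<epsilon>" and T1: "T n (R n \<omega>) \<omega> \<le> ennreal \<epsilon>"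
          and T2: "ennreal (norm (A n) * norm (J n) * R n \<omega>) * T n (R n \<omega>) \<omega> \<le> ennreal \<epsilon>"
        note step = one_step_close[OF n Jn In C(2)[of n, unfolded L_def A_def] less_imp_le[OF \<epsilon>(1)] \<epsilon>(2)
            i[rule_format] w[unfolded W_def J_def dist_norm] T1[unfolded T_def R_def]
            T2[unfolded T_def R_def A_def J_def], folded A_def J_def s_def]
        have "norm (Y n \<omega> + A n *v s n \<omega>) \<le> 4 * k * \<epsilon> * (C * norm (A n *v s n \<omega>) + 1)"
          using step(2) by (simp add: Y_def k_def)
        also have "\<dots> \<le> 4 * k * \<epsilon> * ((C + 1) * (1 + norm (A n *v s n \<omega>)))"
          using C(1) \<epsilon>(1) by (intro mult_left_mono) (auto simp: k_def algebra_simps)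
        also have "\<dots> = 4 * k * (C + 1) * \<epsilon> * (1 + norm (A n *v s n \<omega>))"
          by (simp only: mult_ac)
        also have "\<dots> \<le> c * \<epsilon> * (1 + norm (A n *v s n \<omega>))"
          using c(2) \<epsilon>(1) by (intro mult_right_mono) auto
        also have "\<dots> \<le> \<delta> * (1 + norm (A n *v s n \<omega>))"
          using \<epsilon>(3) by (intro mult_right_mono) auto
        finally show "one_step_defined X M' \<Theta> est n \<omega> \<and>
           norm (Y n \<omega> - - (A n *v s n \<omega>)) \<le> \<delta> * (1 + norm (- (A n *v s n \<omega>)))"
          using step(1) by simp
      qed
    qed
  qed
  have "(\<lambda>n. measure (P n) {\<omega> \<in> space (P n). one_step_defined X M' \<Theta> est n \<omega>}) \<longlonglongrightarrow> 1"
  proof (rule tendsto_prob_1_of_with_high_prob[OF prob])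
    show "with_high_prob P (one_step_defined X M' \<Theta> est)"
      by (rule with_high_prob_mono[OF close[OF zero_less_one]]) auto
    show "{\<omega> \<in> space (P n). one_step_defined X M' \<Theta> est n \<omega>} \<in> sets (P n)" for n
      using est open_Theta meas_M_est meas_M'_est by (rule sets_one_step_defined)
  qed
  moreover have "converges_in_distr P Y std_normal_vec"
  proof (rule converges_in_distr_perturb[OF prob _ Y])
    show "converges_in_distr P (\<lambda>n \<omega>. - (A n *v s n \<omega>)) std_normal_vec"
      using b_clt std_normal_vec_symmetric
      by (intro converges_in_distr_uminus Z) (auto simp: A_def s_def)
    show "(\<lambda>\<omega>. - (A n *v s n \<omega>)) \<in> borel_measurable (P n)" for n
      by (rule borel_measurable_uminus[OF Z])
    show "with_high_prob P (\<lambda>n \<omega>. norm (Y n \<omega> - - (A n *v s n \<omega>))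
        \<le> \<delta> * (1 + norm (- (A n *v s n \<omega>))))" if "\<delta> > 0" for \<delta>
      by (rule with_high_prob_mono[OF close[OF that]]) auto
  qed (simp add: std_normal_vec_def)
  ultimately show ?thesis by (simp add: Y_def[abs_def] A_def J_def)
qed

end
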